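(* Let $A\in\mathbb{R}^{n\times n}$, $B\in\mathbb{R}^{n\times m}$ and $C\in\mathbb{R}^{p\times n}$. Let $N>0$ be an integer and $h>0$ a constant delay. Let $\Phi_N$ (depending on $P_N,S,R$), $T$ and $F_W$ be as defined in the context, let $\tilde A=T^{-1}AT$, $\tilde B=T^{-1}B$, $\tilde C=CT$, and let $\mathcal M=\begin{bmatrix}I_n&-\tilde A&0_n&0_{n,nN}\end{bmatrix}$. If there exist matrices $P_N\in\mathbb{S}_+^{(N+1)n}$, $S,R\in\mathbb{S}_+^n$, $\bar K\in\mathbb{R}^{m\times p}$ and $\sigma\in\mathbb{R}$ such that $$\Phi_N+\mathrm{He}\left(\left(\sigma\mathcal M+\begin{bmatrix}0_n&0_n&-\tilde B\bar K\tilde C&0_{n,nN}\end{bmatrix}\right)^{\top}F_W\right)\prec 0,$$ then the time-delay system $$\dot x(t)=Ax(t)+Bu(t-h),\quad y(t)=Cx(t),\quad u(t)=Ky(t)\quad (t>0),\qquad x(t)=\phi(t)\ \ (t\in[-h,0]),$$ i.e. $\dot x(t)=Ax(t)+BKCx(t-h)$, is asymptotically stable with the feedback gain $K=\sigma^{-1}\bar K$.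
   Context: Notation: $\mathbb{S}^q$ (resp. $\mathbb{S}_+^q$) is the set of real symmetric (resp. symmetric positive definite) $q\times q$ matrices; $\mathrm{He}(A)=A+A^{\top}$; $\prec0$ means symmetric negative definite; $I_q$ is the identity, $0_{q,r}$ the $q\times r$ zero matrix and $0_q=0_{q,q}$; $\mathrm{diag}$ denotes block-diagonal matrices. The initial condition $\phi$ is continuous on $[-h,0]$. Matrix $\Phi_N$: for $P_N\in\mathbb{S}_+^{(N+1)n}$, $S,R\in\mathbb{S}_+^n$, $$\Phi_N=\mathrm{He}(G_N^{\top}P_NH_N)+\tilde S_N+h^2F_N^{\top}RF_N-\begin{bmatrix}\Gamma_N(0)\\ \vdots\\ \Gamma_N(N)\end{bmatrix}^{\top}R_N\begin{bmatrix}\Gamma_N(0)\\ \vdots\\ \Gamma_N(N)\end{bmatrix},$$ where $\tilde S_N=\mathrm{diag}(0_n,S,-S,0_{Nn})$, $R_N=\mathrm{diag}(R,3R,\dots,(2N+1)R)$, $F_N=\begin{bmatrix}I_n&0_n&0_n&0_{n,nN}\end{bmatrix}$, $$G_N=\begin{bmatrix}0_n&I_n&0_n&0_{n,nN}\\0_{nN,n}&0_{nN,n}&0_{nN,n}&hI_{nN}\end{bmatrix},\qquad H_N=\begin{bmatrix}F_N^{\top}&\Gamma_N^{\top}(0)&\cdots&\Gamma_N^{\top}(N-1)\end{bmatrix}^{\top},$$ $\Gamma_N(q)=\begin{bmatrix}0_n&I_n&(-1)^{q+1}I_n&\gamma_{Nq}^0I_n&\cdots&\gamma_{Nq}^{N-1}I_n\end{bmatrix}$,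 with $\gamma_{Nq}^i=-(2i+1)(1-(-1)^{q+i})$ if $i\le q$ and $\gamma_{Nq}^i=0$ otherwise. Jordan structure and slack variables: $T\in\mathbb{R}^{n\times n}$ is a non singular matrix such that $T^{-1}(-A)T=-\tilde A$ is a real Jordan form of $-A$, with the real Jordan blocks belonging to the same eigenvalue (or the same pair of complex conjugate eigenvalues) placed consecutively. $k$ is the number of distinct eigenvalues (conjugate pairs counted once), $r_j$ is the total size of the blocks of the $j$-th one (so $r_1+\dots+r_k=n$), and $J_j=\begin{bmatrix}0&I_{r_j}&0\end{bmatrix}\in\mathbb{R}^{r_j\times n}$ has $I_{r_j}$ in columns $r_1+\dots+r_{j-1}+1,\dots,r_1+\dots+r_j$. Given real numbers $\varepsilon_i(j)$ ($1\le i\le N+3$, $1\le j\le k$), $\mathcal E_i=\sum_{j=1}^k\varepsilon_i(j)J_j^{\top}J_j$ and $F_W=\begin{bmatrix}\mathcal E_1&\cdots&\mathcal E_{N+3}\end{bmatrix}\in\mathbb{R}^{n\times n(N+3)}$. *)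

theory Defs
  imports Complex_Main "Jordan_Normal_Form.Jordan_Normal_Form"
begin

section \<open>Matrices\<close>

definition posdef_mat :: "nat \<Rightarrow> real mat \<Rightarrow> bool" where
  "posdef_mat d M \<longleftrightarrow> M \<in> carrier_mat d d \<and> transpose_mat M = M \<and>
     (\<forall>v \<in> carrier_vec d. v \<noteq> 0\<^sub>v d \<longrightarrow> v \<bullet> (M *\<^sub>v v) > 0)"

definition negdef_mat :: "nat \<Rightarrow> real mat \<Rightarrow> bool" where
  "negdef_mat d M \<longleftrightarrow> M \<in> carrier_mat d d \<and> transpose_mat M = M \<and>
     (\<forall>v \<in> carrier_vec d. v \<noteq> 0\<^sub>v d \<longrightarrow> v \<bullet> (M *\<^sub>v v) < 0)"

definition He :: "real mat \<Rightarrow> real mat" where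
  "He M = M + transpose_mat M"

text \<open>The matrix made of \<open>p \<times> q\<close> blocks of size \<open>r \<times> c\<close> each, whose block in
  block row \<open>a\<close> and block column \<open>b\<close> (both counted from 0) is \<open>f a b\<close>.\<close>

definition block_mat :: "nat \<Rightarrow> nat \<Rightarrow> nat \<Rightarrow> nat \<Rightarrow> (nat \<Rightarrow> nat \<Rightarrow> 'a mat) \<Rightarrow> 'a mat" where
  "block_mat r c p q f =
     mat (p * r) (q * c) (\<lambda>(i, j). f (i div r) (j div c) $$ (i mod r, j mod c))"

section \<open>The matrix \<open>\<Phi>\<^sub>N\<close>\<close>

text \<open>Block columns \<open>0, 1, 2\<close> correspond to the derivative of the state, the state and the
  delayed state; block column \<open>i + 3\<close> with \<open>i < N\<close> corresponds to the \<open>i\<close>-th Legendre moment.\<close>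

definition gamma_coeff :: "nat \<Rightarrow> nat \<Rightarrow> real" where
  "gamma_coeff q i = (if i \<le> q then - (2 * real i + 1) * (1 - (-1) ^ (q + i)) else 0)"

definition Gamma_mat :: "nat \<Rightarrow> nat \<Rightarrow> nat \<Rightarrow> real mat" where
  "Gamma_mat n N q = block_mat n n 1 (N + 3) (\<lambda>_ b.
     if b = 0 then 0\<^sub>m n n
     else if b = 1 then 1\<^sub>m n
     else if b = 2 then (-1) ^ (q + 1) \<cdot>\<^sub>m 1\<^sub>m n
     else gamma_coeff q (b - 3) \<cdot>\<^sub>m 1\<^sub>m n)"

text \<open>Block column with the entries \<open>\<Gamma>\<^sub>N(0), \<dots>, \<Gamma>\<^sub>N(N)\<close>.\<close>

definition Gamma_stack :: "nat \<Rightarrow> nat \<Rightarrow> real mat" where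
  "Gamma_stack n N = block_mat n ((N + 3) * n) (N + 1) 1 (\<lambda>q _. Gamma_mat n N q)"

definition F_mat :: "nat \<Rightarrow> nat \<Rightarrow> real mat" where
  "F_mat n N = block_mat n n 1 (N + 3) (\<lambda>_ b. if b = 0 then 1\<^sub>m n else 0\<^sub>m n n)"

definition G_mat :: "nat \<Rightarrow> nat \<Rightarrow> real \<Rightarrow> real mat" where
  "G_mat n N h = block_mat n n (N + 1) (N + 3) (\<lambda>a b.
     if a = 0 \<and> b = 1 then 1\<^sub>m n
     else if a \<ge> 1 \<and> b = a + 2 then h \<cdot>\<^sub>m 1\<^sub>m n
     else 0\<^sub>m n n)"

definition H_mat :: "nat \<Rightarrow> nat \<Rightarrow> real mat" where
  "H_mat n N = block_mat n ((N + 3) * n) (N + 1) 1 (\<lambda>a _.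
     if a = 0 then F_mat n N else Gamma_mat n N (a - 1))"

definition S_tilde :: "nat \<Rightarrow> nat \<Rightarrow> real mat \<Rightarrow> real mat" where
  "S_tilde n N S = diag_block_mat [0\<^sub>m n n, S, - S, 0\<^sub>m (N * n) (N * n)]"

definition R_diag :: "nat \<Rightarrow> real mat \<Rightarrow> real mat" where
  "R_diag N R = diag_block_mat (map (\<lambda>i. (2 * real i + 1) \<cdot>\<^sub>m R) [0..<N + 1])"

definition Phi_mat :: "nat \<Rightarrow> nat \<Rightarrow> real \<Rightarrow> real mat \<Rightarrow> real mat \<Rightarrow> real mat \<Rightarrow> real mat" where
  "Phi_mat n N h P S R =
     He (transpose_mat (G_mat n N h) * P * H_mat n N)
     + S_tilde n N S
     + h\<^sup>2 \<cdot>\<^sub>m (transpose_mat (F_mat n N) * R * F_mat n N)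
     - transpose_mat (Gamma_stack n N) * R_diag N R * Gamma_stack n N"

section \<open>Real Jordan form\<close>

text \<open>For real \<open>l\<close> this is the usual \<open>s \<times> s\<close> Jordan block. For nonreal \<open>l = a + b \<i>\<close> it is
  the \<open>2s \<times> 2s\<close> block attached to the conjugate pair of \<open>l\<close>, with \<open>[[a, b], [-b, a]]\<close> on the
  block diagonal. Both signs of \<open>b\<close> are allowed, which covers both conventions in use.\<close>

definition real_jordan_block :: "complex \<Rightarrow> nat \<Rightarrow> real mat" where
  "real_jordan_block l s =
     (if Im l = 0 then jordan_block s (Re l)
      else block_mat 2 2 s s (\<lambda>a b.
        if a = b then mat_of_rows_list 2 [[Re l, Im l], [- Im l, Re l]]
        else if Suc a = b then 1\<^sub>m 2
        else 0\<^sub>m 2 2))"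

text \<open>The data of a real Jordan form: one entry \<open>(l, ss)\<close> per distinct eigenvalue or conjugate
  pair, where \<open>l\<close> is the eigenvalue (any representative of the pair) and \<open>ss\<close> lists the
  orders \<open>s\<close> of its blocks. Blocks of the same eigenvalue are thereby consecutive.\<close>

type_synonym jordan_data = "(complex \<times> nat list) list"

definition jordan_data_ok :: "jordan_data \<Rightarrow> bool" where
  "jordan_data_ok D \<longleftrightarrow> distinct (map (\<lambda>(l, ss). {l, cnj l}) D) \<and>
     (\<forall>(l, ss) \<in> set D. ss \<noteq> [] \<and> 0 \<notin> set ss)"

definition real_jordan_matrix :: "jordan_data \<Rightarrow> real mat" where
  "real_jordan_matrix D =
     diag_block_mat (concat (map (\<lambda>(l, ss). map (real_jordan_block l) ss) D))"

text \<open>The numbers \<open>r\<^sub>1, \<dots>, r\<^sub>k\<close>.\<close>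

definition jordan_sizes :: "jordan_data \<Rightarrow> nat list" where
  "jordan_sizes D = map (\<lambda>(l, ss). (if Im l = 0 then 1 else 2) * sum_list ss) D"

section \<open>Slack variables\<close>

text \<open>The index \<open>j\<close> of the eigenvalue and the index \<open>i\<close> of the block column are counted from 0.\<close>

definition J_mat :: "nat \<Rightarrow> nat list \<Rightarrow> nat \<Rightarrow> real mat" where
  "J_mat n rs j = mat (rs ! j) n (\<lambda>(a, b). if b = sum_list (take j rs) + a then 1 else 0)"

text \<open>\<open>\<Sum>\<^sub>j \<epsilon>\<^sub>i(j) J\<^sub>j\<^sup>T J\<^sub>j\<close>, with the matrix sum taken entrywise.\<close>

definition E_mat :: "nat \<Rightarrow> nat list \<Rightarrow> (nat \<Rightarrow> nat \<Rightarrow> real) \<Rightarrow> nat \<Rightarrow> real mat" where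
  "E_mat n rs eps i = mat n n (\<lambda>ab.
     \<Sum>j<length rs. (eps i j \<cdot>\<^sub>m (transpose_mat (J_mat n rs j) * J_mat n rs j)) $$ ab)"

definition FW_mat :: "nat \<Rightarrow> nat \<Rightarrow> nat list \<Rightarrow> (nat \<Rightarrow> nat \<Rightarrow> real) \<Rightarrow> real mat" where
  "FW_mat n N rs eps = block_mat n n 1 (N + 3) (\<lambda>_ i. E_mat n rs eps i)"

definition M_mat :: "nat \<Rightarrow> nat \<Rightarrow> real mat \<Rightarrow> real mat" where
  "M_mat n N A = block_mat n n 1 (N + 3) (\<lambda>_ b.
     if b = 0 then 1\<^sub>m n else if b = 1 then - A else 0\<^sub>m n n)"

definition delayed_mat :: "nat \<Rightarrow> nat \<Rightarrow> real mat \<Rightarrow> real mat" where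
  "delayed_mat n N X = block_mat n n 1 (N + 3) (\<lambda>_ b. if b = 2 then X else 0\<^sub>m n n)"

section \<open>Time-delay systems under static output feedback\<close>

definition vec_nrm :: "real vec \<Rightarrow> real" where
  "vec_nrm v = sqrt (v \<bullet> v)"

text \<open>There is no topology on the type of vectors with variable dimension, so continuity and
  differentiability are stated componentwise.\<close>

definition initial_condition :: "nat \<Rightarrow> real \<Rightarrow> (real \<Rightarrow> real vec) \<Rightarrow> bool" where
  "initial_condition n h \<phi> \<longleftrightarrow> (\<forall>t \<in> {-h..0}. \<phi> t \<in> carrier_vec n) \<and>
     (\<forall>i<n. continuous_on {-h..0} (\<lambda>t. \<phi> t $ i))"

definition is_solution ::
  "nat \<Rightarrow> real \<Rightarrow> real mat \<Rightarrow> real mat \<Rightarrow> real mat \<Rightarrow> real mat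
     \<Rightarrow> (real \<Rightarrow> real vec) \<Rightarrow> (real \<Rightarrow> real vec) \<Rightarrow> bool" where
  "is_solution n h A B C K \<phi> x \<longleftrightarrow>
     (let y = (\<lambda>t. C *\<^sub>v x t); u = (\<lambda>t. K *\<^sub>v y t) in
       (\<forall>t \<ge> -h. x t \<in> carrier_vec n) \<and>
       (\<forall>i<n. continuous_on {-h..} (\<lambda>t. x t $ i)) \<and>
       (\<forall>t \<in> {-h..0}. x t = \<phi> t) \<and>
       (\<forall>t>0. \<forall>i<n.
          ((\<lambda>s. x s $ i) has_real_derivative (A *\<^sub>v x t + B *\<^sub>v u (t - h)) $ i) (at t)))"

text \<open>Lyapunov stability of the zero solution together with global attractivity.\<close>

definition asymptotically_stable ::
  "nat \<Rightarrow> real \<Rightarrow> real mat \<Rightarrow> real mat \<Rightarrow> real mat \<Rightarrow> real mat \<Rightarrow> bool" where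
  "asymptotically_stable n h A B C K \<longleftrightarrow>
     (\<forall>e>0. \<exists>d>0. \<forall>\<phi> x. initial_condition n h \<phi> \<longrightarrow> is_solution n h A B C K \<phi> x \<longrightarrow>
        (\<forall>t \<in> {-h..0}. vec_nrm (\<phi> t) < d) \<longrightarrow> (\<forall>t\<ge>0. vec_nrm (x t) < e)) \<and>
     (\<forall>\<phi> x. initial_condition n h \<phi> \<longrightarrow> is_solution n h A B C K \<phi> x \<longrightarrow>
        ((\<lambda>t. vec_nrm (x t)) \<longlongrightarrow> 0) at_top)"

end

theory Submission
  imports "HOL-Analysis.Henstock_Kurzweil_Integration" Defs
begin

text \<open>The Lyapunov--Krasovskii functional
  \<open>V = \<zeta> \<bullet> P \<zeta> + \<integral>\<^bsub>[t - h, t]\<^esub> z \<bullet> S z + h \<integral>\<^bsub>[t - h, t]\<^esub> (s - t + h) (z' \<bullet> R z')(s) ds\<close>, where \<open>\<zeta>\<close> consists of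
  \<open>z = T\<^sup>-\<^sup>1 x\<close> and its first \<open>N\<close> Legendre moments over the delay interval, satisfies \<open>V' \<le> \<xi> \<bullet> \<Phi>\<^sub>N \<xi>\<close> with
  \<open>\<xi> = (z', z, z(t - h), moments)\<close>, by Bessel's inequality for \<open>z'\<close>. Along solutions \<open>\<sigma> \<M> \<xi> + [0, 0, X, 0] \<xi> = 0\<close>, so
  the slack term contributes nothing and \<open>V' \<le> - e |z|\<^sup>2\<close>. Since \<open>z'\<close> exists only for \<open>t > 0\<close>, this is used for
  \<open>t > h\<close>, and a Gronwall estimate covers \<open>[0, 2h]\<close>; attractivity follows by Barbalat's argument.\<close>

text \<open>The matrices of the LMI fit together because along a solution \<open>Gamma_vec\<close>
  has two meanings. It is the derivative of \<open>h\<close> times the \<open>q\<close>-th moment,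
  so that \<open>G_mat\<close> and \<open>H_mat\<close> turn \<xi> into \<zeta> and its derivative.
  It is also \<open>h\<close> times the \<open>q\<close>-th Legendre coefficient of z', so that the
  \<open>R_diag\<close> term is a Bessel bound. Both follow from one integration by parts, in which
  the numbers \<open>gamma_coeff\<close> are minus the coefficients of a differentiated Legendre
  polynomial in the Legendre basis. The condition is linear in \<open>Kbar\<close> because
  \<open>Kbar\<close> stands for \<sigma> K; recovering K divides by \<sigma>, so \<sigma> \<noteq>
  0 has to be read off from the inequality itself. Stability needs constants that do not depend on
  the solution. The functional contains z', while the initial function is merely continuous, so
  initial data cannot bound the functional at time 0. At time 2h they can: the equation expresses z'
  on [h, 2h] through z on [0, 2h], and growth estimates reach back to [-h, 0].\<close>

unbundle no inner_syntax
unbundle no vec_syntax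
hide_const (open) Module.smult

section \<open>Shifted Legendre polynomials\<close>

text \<open>Bonnet's recursion with argument 2u - 1: the Legendre polynomials moved from [-1, 1] to
  [0, 1], normalised to take the value 1 at u = 1. The recursive form lets endpoint values and
  derivative identities be proved by induction.\<close>

fun legendre :: "nat \<Rightarrow> real poly" where
  "legendre 0 = 1"
| "legendre (Suc 0) = [:-1, 2:]"
| "legendre (Suc (Suc k)) = smult (inverse (real k + 2))
     (smult (2 * real k + 3) ([:-1, 2:] * legendre (Suc k)) - smult (real k + 1) (legendre k))"

lemma legendre_recurrence:
  "(real k + 2) * poly (legendre (Suc (Suc k))) u =
     (2 * real k + 3) * ((2 * u - 1) * poly (legendre (Suc k)) u) - (real k + 1) * poly (legendre k) u"
proof -
  have "poly (legendre (Suc (Suc k))) u = inverse (real k + 2) *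
     ((2 * real k + 3) * ((2 * u - 1) * poly (legendre (Suc k)) u) - (real k + 1) * poly (legendre k) u)"
    by (simp del: mult_pCons_left)
  thus ?thesis
    by (simp del: legendre.simps)
qed

lemma legendre_recurrence_deriv:
  "(real k + 2) * poly (pderiv (legendre (Suc (Suc k)))) u =
     (2 * real k + 3) * (2 * poly (legendre (Suc k)) u + (2 * u - 1) * poly (pderiv (legendre (Suc k))) u)
     - (real k + 1) * poly (pderiv (legendre k)) u"
proof -
  have "pderiv [:- 1, 2 :: real:] = [:2:]"
    by (simp add: pderiv_pCons)
  hence "poly (pderiv (legendre (Suc (Suc k)))) u = inverse (real k + 2) *
     ((2 * real k + 3) * (2 * poly (legendre (Suc k)) u + (2 * u - 1) * poly (pderiv (legendre (Suc k))) u)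
     - (real k + 1) * poly (pderiv (legendre k)) u)"
    by (simp del: mult_pCons_left add: pderiv_smult pderiv_diff pderiv_mult)
  thus ?thesis
    by (simp del: legendre.simps)
qed

lemma legendre_at_1: "poly (legendre k) 1 = 1"
proof (induction k rule: legendre.induct)
  case (3 k)
  hence "(real k + 2) * poly (legendre (Suc (Suc k))) 1 = real k + 2"
    unfolding legendre_recurrence by (simp add: algebra_simps)
  thus ?case by (simp del: legendre.simps)
qed auto

lemma legendre_at_0: "poly (legendre k) 0 = (-1) ^ k"
proof (induction k rule: legendre.induct)
  case (3 k)
  hence "(real k + 2) * poly (legendre (Suc (Suc k))) 0 = (real k + 2) * (-1) ^ k"
    unfolding legendre_recurrence by (simp add: algebra_simps)
  thus ?case by (simp del: legendre.simps)
qed auto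

text \<open>Two classical identities in x = 2u - 1, the factors 2 coming from the chain rule. They
  are proved jointly: the second one at k eliminates \<open>d0\<close> from the differentiated
  recursion and yields the first one at k + 1, which together with both hypotheses yields the
  second. Subtracting shifted instances then cancels the terms containing x.\<close>

lemma legendre_deriv_aux:
  "poly (pderiv (legendre (Suc k))) u =
     (2 * u - 1) * poly (pderiv (legendre k)) u + 2 * (real k + 1) * poly (legendre k) u \<and>
   (2 * u - 1) * poly (pderiv (legendre (Suc k))) u - poly (pderiv (legendre k)) u =
     2 * (real k + 1) * poly (legendre (Suc k)) u"
proof (induction k)
  case 0
  show ?case by (simp add: pderiv_pCons)
next
  case (Suc k)
  define x p0 p1 p2 d0 d1 d2 where defs: "x = 2 * u - 1" "p0 = poly (legendre k) u"
    "p1 = poly (legendre (Suc k)) u" "p2 = poly (legendre (Suc (Suc k))) u"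
    "d0 = poly (pderiv (legendre k)) u" "d1 = poly (pderiv (legendre (Suc k))) u"
    "d2 = poly (pderiv (legendre (Suc (Suc k)))) u"
  have A: "d1 = x * d0 + 2 * (real k + 1) * p0" and B: "x * d1 - d0 = 2 * (real k + 1) * p1"
    using Suc unfolding defs by auto
  have r: "(real k + 2) * p2 = (2 * real k + 3) * (x * p1) - (real k + 1) * p0"
    unfolding defs by (rule legendre_recurrence)
  have d: "(real k + 2) * d2 = (2 * real k + 3) * (2 * p1 + x * d1) - (real k + 1) * d0"
    unfolding defs by (rule legendre_recurrence_deriv)
  have "(real k + 2) * d2 = (real k + 2) * (x * d1 + 2 * (real k + 2) * p1)"
  proof -
    have d0: "d0 = x * d1 - 2 * (real k + 1) * p1"
      using B by simp
    show ?thesis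
      unfolding d d0 by (simp add: algebra_simps)
  qed
  hence 1: "d2 = x * d1 + 2 * (real k + 2) * p1"
    by simp
  have 2: "x * d2 - d1 = 2 * (real k + 2) * p2"
  proof -
    have xd1: "x * d1 = d0 + 2 * (real k + 1) * p1" and xd0: "x * d0 = d1 - 2 * (real k + 1) * p0"
      using A B by simp_all
    have "x * d2 - d1 = x * (x * d1) + 2 * (real k + 2) * (x * p1) - d1"
      unfolding 1 by (simp add: algebra_simps)
    also have "\<dots> = x * d0 + 2 * (real k + 1) * (x * p1) + 2 * (real k + 2) * (x * p1) - d1"
      unfolding xd1 by (simp add: algebra_simps)
    also have "\<dots> = 2 * ((2 * real k + 3) * (x * p1) - (real k + 1) * p0)"
      unfolding xd0 by (simp add: algebra_simps)
    finally show ?thesis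
      unfolding r[symmetric] by (simp add: algebra_simps)
  qed
  show ?case
    using 1 2 unfolding defs by (simp del: legendre.simps add: algebra_simps)
qed

lemma legendre_deriv_step:
  "pderiv (legendre (Suc (Suc k))) - pderiv (legendre k) = smult (2 * (2 * real k + 3)) (legendre (Suc k))"
proof -
  have "poly (pderiv (legendre (Suc (Suc k))) - pderiv (legendre k)) u =
      poly (smult (2 * (2 * real k + 3)) (legendre (Suc k))) u" for u
    using legendre_deriv_aux[of k u] legendre_deriv_aux[of "Suc k" u]
    by (simp del: legendre.simps add: algebra_simps)
  thus ?thesis
    using poly_eq_poly_eq_iff by blast
qed

text \<open>This is the origin of the numbers in \<open>Gamma_mat\<close>. Going from k to k + 2
  leaves the old coefficients unchanged, since only the parity of k + i matters; the index k
  contributes 0 by parity, and the index k + 1 contributes the term from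
  \<open>legendre_deriv_step\<close>.\<close>

lemma pderiv_legendre:
  "pderiv (legendre k) = - (\<Sum>i<k. smult (gamma_coeff k i) (legendre i))"
proof (induction k rule: legendre.induct)
  case (3 k)
  have "gamma_coeff (Suc (Suc k)) i = gamma_coeff k i" if "i < k" for i
    using that by (auto simp: gamma_coeff_def)
  moreover have "gamma_coeff (Suc (Suc k)) k = 0"
    by (simp add: gamma_coeff_def flip: power_add mult_2)
  moreover have "gamma_coeff (Suc (Suc k)) (Suc k) = - (2 * (2 * real k + 3))"
    by (simp add: gamma_coeff_def algebra_simps flip: power_add mult_2)
  hence "smult (gamma_coeff (Suc (Suc k)) (Suc k)) q = - smult (2 * (2 * real k + 3)) q" for q
    by (metis smult_minus_left)
  ultimately have "(\<Sum>i<Suc (Suc k). smult (gamma_coeff (Suc (Suc k)) i) (legendre i)) =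
      (\<Sum>i<k. smult (gamma_coeff k i) (legendre i)) - smult (2 * (2 * real k + 3)) (legendre (Suc k))"
    by simp
  with 3 legendre_deriv_step[of k] show ?case
    by (simp del: legendre.simps sum.lessThan_Suc add: algebra_simps flip: smult_minus_left)
qed (auto simp: gamma_coeff_def pderiv_pCons)

section \<open>Integration over the unit interval and orthogonality\<close>

definition integral01 :: "real poly \<Rightarrow> real" where
  "integral01 q = integral {0..1} (poly q)"

lemma poly_integrable [simp]: "poly (q :: real poly) integrable_on {a..b}"
  by (intro integrable_continuous_real continuous_intros)

lemma integral01_linear:
  "integral01 (p + q) = integral01 p + integral01 q"
  "integral01 (p - q) = integral01 p - integral01 q"
  "integral01 (smult c p) = c * integral01 p"
proof -
  have eq: "poly (p + q) = (\<lambda>u. poly p u + poly q u)" "poly (p - q) = (\<lambda>u. poly p u - poly q u)"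
    "poly (smult c p) = (\<lambda>u. c * poly p u)"
    by auto
  show "integral01 (p + q) = integral01 p + integral01 q" "integral01 (p - q) = integral01 p - integral01 q"
    "integral01 (smult c p) = c * integral01 p"
    unfolding integral01_def eq by (simp_all add: integral_add integral_diff)
qed

lemma integral01_0: "integral01 0 = 0"
  using integral01_linear(3)[of 0 0] by simp

lemma integral01_sum: "integral01 (\<Sum>i\<in>I. f i) = (\<Sum>i\<in>I. integral01 (f i))"
  by (induction I rule: infinite_finite_induct) (simp_all add: integral01_linear integral01_0)

lemma integral01_pderiv: "integral01 (pderiv q) = poly q 1 - poly q 0"
proof -
  have "(poly (pderiv q) has_integral poly q 1 - poly q 0) {0..1}"
    by (rule fundamental_theorem_of_calculus)
      (auto simp: has_real_derivative_iff_has_vector_derivative[symmetric] intro!: DERIV_subset[OF poly_DERIV])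
  thus ?thesis
    by (simp add: integral01_def integral_unique)
qed

text \<open>Choose a polynomial q whose derivative is a multiple of \<open>legendre k\<close>, and
  integrate q' times \<open>legendre l\<close> by parts. Differentiating \<open>legendre l\<close>
  leaves only Legendre polynomials of index below l, so the induction hypothesis evaluates every
  remaining integral. Keeping k arbitrary in the induction is essential, as q involves other indices
  than k.\<close>

lemma legendre_orthogonal:
  "integral01 (legendre k * legendre l) = (if k = l then inverse (2 * real k + 1) else 0)"
proof (induction l arbitrary: k rule: less_induct)
  case (less l)
  have parts: "integral01 (pderiv q * legendre l) = poly q 1 - poly q 0 * (-1) ^ l
      + (\<Sum>j<l. gamma_coeff l j * integral01 (q * legendre j))" for q
  proof -
    have "poly q 1 - poly q 0 * (-1) ^ l = integral01 (pderiv (q * legendre l))"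
      by (simp add: integral01_pderiv legendre_at_0 legendre_at_1)
    also have "\<dots> = integral01 (pderiv q * legendre l) - integral01 (\<Sum>j<l. smult (gamma_coeff l j) (q * legendre j))"
      by (simp add: pderiv_mult pderiv_legendre[of l] integral01_linear(2)[symmetric] sum_distrib_left algebra_simps)
    finally show ?thesis
      by (simp add: integral01_sum integral01_linear)
  qed
  show ?case
  proof (cases k)
    case 0
    have "pderiv (legendre 1) = smult 2 (legendre 0)"
      by (simp add: pderiv_pCons)
    hence "2 * integral01 (legendre 0 * legendre l) = integral01 (pderiv (legendre 1) * legendre l)"
      by (simp add: integral01_linear)
    also have "\<dots> = 1 + (-1) ^ l + (\<Sum>j<l. gamma_coeff l j * integral01 (legendre 1 * legendre j))"
      by (subst parts) simp
    also have "(\<Sum>j<l. gamma_coeff l j * integral01 (legendre 1 * legendre j)) =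
       (\<Sum>j<l. if 1 = j then gamma_coeff l j / 3 else 0)"
      by (rule sum.cong) (auto simp: less simp del: legendre.simps)
    also have "\<dots> = (if 1 < l then gamma_coeff l 1 / 3 else 0)"
      by simp
    finally show ?thesis
      using 0 by (cases "l = 0"; cases "l = 1") (auto simp: gamma_coeff_def diff_divide_distrib)
  next
    case (Suc k')
    \<comment> \<open>Here q is the difference of the neighbours of index k + 1 and k - 1. They
      agree at both endpoints, so the boundary terms vanish.\<close>
    have "2 * (2 * real k' + 3) * integral01 (legendre k * legendre l) =
        integral01 (pderiv (legendre (Suc (Suc k')) - legendre k') * legendre l)"
      by (simp add: Suc pderiv_diff legendre_deriv_step integral01_linear del: legendre.simps)
    also have "\<dots> = (\<Sum>j<l. gamma_coeff l j *
        (integral01 (legendre (Suc (Suc k')) * legendre j) - integral01 (legendre k' * legendre j)))"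
      by (subst parts) (simp add: legendre_at_0 legendre_at_1 algebra_simps integral01_linear del: legendre.simps)
    also have "\<dots> = (\<Sum>j<l. (if Suc (Suc k') = j then gamma_coeff l j / (2 * real k' + 5) else 0)
         - (if k' = j then gamma_coeff l j / (2 * real k' + 1) else 0))"
      by (rule sum.cong) (auto simp: less divide_simps simp del: legendre.simps)
    also have "\<dots> = (if Suc (Suc k') < l then gamma_coeff l (Suc (Suc k')) / (2 * real k' + 5) else 0)
         - (if k' < l then gamma_coeff l k' / (2 * real k' + 1) else 0)"
      by (simp add: sum_subtractf)
    also have "\<dots> = (if k = l then 2 else 0)"
    proof -
      have nz: "2 * real k' + 1 \<noteq> 0" "2 * real k' + 5 \<noteq> 0"
        by linarith+
      have g1: "gamma_coeff l k' / (2 * real k' + 1) = - (1 - (-1) ^ (l + k'))" if "k' < l"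
        using that nz by (simp add: gamma_coeff_def field_simps)
      have g2: "gamma_coeff l (Suc (Suc k')) / (2 * real k' + 5) = - (1 - (-1) ^ (l + k'))" if "Suc (Suc k') < l"
        using that nz by (simp add: gamma_coeff_def field_simps)
      have g3: "(-1 :: real) ^ (Suc k' + k') = -1" "(-1 :: real) ^ (Suc (Suc k') + k') = 1"
        by (simp_all flip: mult_2)
      \<comment> \<open>For l > k + 1 the two remaining terms are equal and cancel; for l = k + 1
        the second one vanishes by parity; for l = k it gives 2; for smaller l neither
        occurs.\<close>
      consider "Suc (Suc k') < l" | "l = Suc (Suc k')" | "l = Suc k'" | "l \<le> k'"
        by linarith
      thus ?thesis
        by cases (use g1 g2 g3 in \<open>simp_all add: Suc\<close>)
    qed
    also have "\<dots> = 2 * (2 * real k' + 3) * (if k = l then inverse (2 * real k + 1) else 0)"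
    proof -
      have e: "2 * real k + 1 = 2 * real k' + 3" and nz: "2 * real k' + 3 \<noteq> 0"
        by (simp add: Suc) linarith
      have "(if b then 2 else 0) = 2 * x * (if b then inverse x else 0)" if "x \<noteq> 0" for b and x :: real
        using that by simp
      from this[OF nz] show ?thesis unfolding e .
    qed
    finally show ?thesis
      by (subst (asm) mult_cancel_left) auto
  qed
qed

section \<open>Quadratic forms\<close>

lemma abs_scalar_prod_le:
  fixes v w :: "real vec"
  assumes "v \<in> carrier_vec n" "w \<in> carrier_vec n"
  shows "\<bar>v \<bullet> w\<bar> \<le> (v \<bullet> v + w \<bullet> w) / 2"
proof -
  have *: "\<bar>v $ i * w $ i\<bar> \<le> (v $ i * v $ i + w $ i * w $ i) / 2" for i
    using zero_le_power2[of "v $ i - w $ i"] zero_le_power2[of "v $ i + w $ i"]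
    by (auto simp: abs_le_iff power2_eq_square algebra_simps)
  have "\<bar>v \<bullet> w\<bar> \<le> (\<Sum>i=0..<n. (v $ i * v $ i + w $ i * w $ i) / 2)"
    unfolding scalar_prod_def carrier_vecD[OF assms(2)] by (rule order.trans[OF sum_abs sum_mono]) (rule *)
  thus ?thesis
    using assms by (simp add: scalar_prod_def sum.distrib flip: sum_divide_distrib)
qed

lemma scalar_prod_self_nonneg: "0 \<le> v \<bullet> (v :: real vec)"
  unfolding scalar_prod_def by (rule sum_nonneg) auto

lemma component_le_scalar_prod_self:
  fixes v :: "real vec"
  assumes "v \<in> carrier_vec n" "i < n"
  shows "(v $ i)\<^sup>2 \<le> v \<bullet> v"
proof -
  have "(v $ i)\<^sup>2 \<le> (\<Sum>i=0..<n. (v $ i)\<^sup>2)"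
    using assms by (intro member_le_sum) auto
  thus ?thesis
    using assms by (simp add: scalar_prod_def power2_eq_square)
qed

lemma scalar_prod_self_le:
  fixes v :: "real vec"
  assumes "v \<in> carrier_vec n" "\<And>i. i < n \<Longrightarrow> (v $ i)\<^sup>2 \<le> c"
  shows "v \<bullet> v \<le> real n * c"
proof -
  have "v \<bullet> v = (\<Sum>i=0..<n. (v $ i)\<^sup>2)"
    using assms(1) by (simp add: scalar_prod_def power2_eq_square)
  also have "\<dots> \<le> (\<Sum>i=0..<n. c)"
    using assms(2) by (intro sum_mono) auto
  finally show ?thesis by simp
qed

lemma mult_mat_vec_bound:
  fixes M :: "real mat"
  assumes "M \<in> carrier_mat n m"
  shows "\<exists>c>0. \<forall>v\<in>carrier_vec m. (M *\<^sub>v v) \<bullet> (M *\<^sub>v v) \<le> c * (v \<bullet> v)"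
proof -
  \<comment> \<open>The sum of all absolute entries dominates each row sum. The \<open>+ 1\<close>
    in the final constant keeps it positive for the zero matrix.\<close>
  define b where "b = (\<Sum>i<n. \<Sum>j<m. \<bar>M $$ (i, j)\<bar>)"
  have b0: "b \<ge> 0"
    unfolding b_def by (intro sum_nonneg) auto
  have "(M *\<^sub>v v) \<bullet> (M *\<^sub>v v) \<le> (real n * b\<^sup>2 + 1) * (v \<bullet> v)" if v: "v \<in> carrier_vec m" for v
  proof -
    have "((M *\<^sub>v v) $ i)\<^sup>2 \<le> b\<^sup>2 * (v \<bullet> v)" if i: "i < n" for i
    proof -
      have comp: "\<bar>v $ j\<bar> \<le> sqrt (v \<bullet> v)" if "j < m" for j
        using component_le_scalar_prod_self[OF v that] by (simp add: real_le_rsqrt)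
      have "(M *\<^sub>v v) $ i = (\<Sum>j=0..<m. M $$ (i, j) * v $ j)"
        using assms v i by (simp add: scalar_prod_def)
      also have "\<bar>\<dots>\<bar> \<le> (\<Sum>j<m. \<bar>M $$ (i, j)\<bar> * sqrt (v \<bullet> v))"
        unfolding atLeast0LessThan using comp
        by (intro order.trans[OF sum_abs] sum_mono) (auto simp: abs_mult intro!: mult_left_mono)
      also have "\<dots> \<le> b * sqrt (v \<bullet> v)"
        unfolding b_def sum_distrib_right[symmetric] using i
        by (intro mult_right_mono member_le_sum[where f = "\<lambda>i. \<Sum>j<m. \<bar>M $$ (i, j)\<bar>"])
          (auto intro!: sum_nonneg scalar_prod_self_nonneg)
      finally have "\<bar>(M *\<^sub>v v) $ i\<bar>\<^sup>2 \<le> (b * sqrt (v \<bullet> v))\<^sup>2"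
        by (intro power_mono) auto
      thus ?thesis
        by (simp add: power_mult_distrib scalar_prod_self_nonneg)
    qed
    hence "(M *\<^sub>v v) \<bullet> (M *\<^sub>v v) \<le> real n * (b\<^sup>2 * (v \<bullet> v))"
      using assms v by (intro scalar_prod_self_le) auto
    thus ?thesis
      using scalar_prod_self_nonneg[of v] by (simp add: algebra_simps)
  qed
  moreover have "0 < real n * b\<^sup>2 + 1"
    by (intro add_nonneg_pos mult_nonneg_nonneg) auto
  ultimately show ?thesis
    by blast
qed

lemma bilinear_form_bound:
  fixes M :: "real mat"
  assumes "M \<in> carrier_mat n m"
  shows "\<exists>c>0. \<forall>v\<in>carrier_vec n. \<forall>w\<in>carrier_vec m. \<bar>v \<bullet> (M *\<^sub>v w)\<bar> \<le> c * (v \<bullet> v + w \<bullet> w)"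
proof -
  obtain c where c: "c > 0" "\<And>w. w \<in> carrier_vec m \<Longrightarrow> (M *\<^sub>v w) \<bullet> (M *\<^sub>v w) \<le> c * (w \<bullet> w)"
    using mult_mat_vec_bound[OF assms] by blast
  have "\<bar>v \<bullet> (M *\<^sub>v w)\<bar> \<le> (c + 1) * (v \<bullet> v + w \<bullet> w)"
    if "v \<in> carrier_vec n" "w \<in> carrier_vec m" for v w
  proof -
    have "\<bar>v \<bullet> (M *\<^sub>v w)\<bar> \<le> (v \<bullet> v + (M *\<^sub>v w) \<bullet> (M *\<^sub>v w)) / 2"
      using assms that by (intro abs_scalar_prod_le) auto
    also have "\<dots> \<le> v \<bullet> v + c * (w \<bullet> w)"
      using c(2)[OF that(2)] scalar_prod_self_nonneg[of v] scalar_prod_self_nonneg[of "M *\<^sub>v w"] by simp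
    also have "\<dots> \<le> (c + 1) * (v \<bullet> v + w \<bullet> w)"
      using c(1) scalar_prod_self_nonneg[of v] scalar_prod_self_nonneg[of w] by (simp add: algebra_simps)
    finally show ?thesis .
  qed
  with c(1) show ?thesis
    by (intro exI[of _ "c + 1"]) auto
qed

lemma sym_mat_scalar_prod:
  fixes M :: "real mat"
  assumes "M \<in> carrier_mat n n" "transpose_mat M = M" "v \<in> carrier_vec n" "w \<in> carrier_vec n"
  shows "v \<bullet> (M *\<^sub>v w) = w \<bullet> (M *\<^sub>v v)"
  by (metis assms comm_scalar_prod mult_mat_vec_carrier transpose_vec_mult_scalar)

lemma mult_minus_distrib_mat_vec_real:
  fixes M :: "real mat"
  assumes "M \<in> carrier_mat n m" "v \<in> carrier_vec m" "w \<in> carrier_vec m"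
  shows "M *\<^sub>v (v - w) = M *\<^sub>v v - M *\<^sub>v w"
  by (rule eq_vecI) (use assms in \<open>auto simp: scalar_prod_minus_distrib[of _ m]\<close>)

lemma posdef_mat_nonneg:
  assumes "posdef_mat n M" "v \<in> carrier_vec n"
  shows "0 \<le> v \<bullet> (M *\<^sub>v v)"
  using assms by (cases "v = 0\<^sub>v n") (auto simp: posdef_mat_def less_imp_le)

text \<open>With \<open>w = M v\<close>, nonnegativity of the form at \<open>v - t w\<close> for a small \<open>t > 0\<close> bounds \<open>|w|\<^sup>2\<close> by a
  multiple of \<open>v \<bullet> M v\<close>, and \<open>|v|\<^sup>2\<close> is bounded by a multiple of \<open>|w|\<^sup>2\<close> because \<open>M\<close> is invertible.
  This avoids a compactness argument.\<close>

lemma posdef_mat_coercive: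
  assumes "posdef_mat n M"
  shows "\<exists>e>0. \<forall>v\<in>carrier_vec n. v \<bullet> (M *\<^sub>v v) \<ge> e * (v \<bullet> v)"
proof -
  have M: "M \<in> carrier_mat n n" and sym: "transpose_mat M = M"
    and pos: "\<And>v. v \<in> carrier_vec n \<Longrightarrow> v \<noteq> 0\<^sub>v n \<Longrightarrow> v \<bullet> (M *\<^sub>v v) > 0"
    using assms by (auto simp: posdef_mat_def)
  have "det M \<noteq> 0"
    using pos by (force simp: det_0_iff_vec_prod_zero_field[OF M])
  from det_non_zero_imp_unit[OF M this, of "()"]
  obtain L where LM: "L * M = 1\<^sub>m n" and L: "L \<in> carrier_mat n n"
    unfolding Units_def ring_mat_def by auto
  obtain c where c: "c > 0" "\<And>w. w \<in> carrier_vec n \<Longrightarrow> (L *\<^sub>v w) \<bullet> (L *\<^sub>v w) \<le> c * (w \<bullet> w)"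
    using mult_mat_vec_bound[OF L] by blast
  obtain b where b: "b > 0"
    "\<And>v w. v \<in> carrier_vec n \<Longrightarrow> w \<in> carrier_vec n \<Longrightarrow> \<bar>v \<bullet> (M *\<^sub>v w)\<bar> \<le> b * (v \<bullet> v + w \<bullet> w)"
    using bilinear_form_bound[OF M] by blast
  have "inverse (2 * b * c) * (v \<bullet> v) \<le> v \<bullet> (M *\<^sub>v v)" if v: "v \<in> carrier_vec n" for v
  proof -
    define w where "w = M *\<^sub>v v"
    \<comment> \<open>With this value the quadratic term is at most t |w|^2, so it consumes only
      half of the linear gain 2 t |w|^2.\<close>
    define t where "t = inverse (2 * b)"
    have w: "w \<in> carrier_vec n" using M v by (simp add: w_def)
    have "v = L *\<^sub>v w"
      using LM L M v by (simp add: w_def flip: assoc_mult_mat_vec)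
    hence vw: "v \<bullet> v \<le> c * (w \<bullet> w)"
      using c(2)[OF w] by simp
    have wMw: "w \<bullet> (M *\<^sub>v w) \<le> 2 * b * (w \<bullet> w)"
      using b(2)[OF w w] by simp
    have vMw: "v \<bullet> (M *\<^sub>v w) = w \<bullet> w"
      unfolding sym_mat_scalar_prod[OF M sym v w] by (simp add: w_def)
    have "0 \<le> (v - t \<cdot>\<^sub>v w) \<bullet> (M *\<^sub>v (v - t \<cdot>\<^sub>v w))"
      using v w by (intro posdef_mat_nonneg[OF assms]) auto
    also have "M *\<^sub>v (v - t \<cdot>\<^sub>v w) = w - t \<cdot>\<^sub>v (M *\<^sub>v w)"
      using M v w by (simp add: mult_minus_distrib_mat_vec_real[OF M] mult_mat_vec[OF M] w_def)
    also have "(v - t \<cdot>\<^sub>v w) \<bullet> (w - t \<cdot>\<^sub>v (M *\<^sub>v w)) = v \<bullet> (M *\<^sub>v v) - 2 * t * (w \<bullet> w) + t * t * (w \<bullet> (M *\<^sub>v w))"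
      using M v w vMw
      by (simp add: scalar_prod_minus_distrib[of _ n] minus_scalar_prod_distrib[of _ n] right_diff_distrib flip: w_def)
    also have "\<dots> \<le> v \<bullet> (M *\<^sub>v v) - 2 * t * (w \<bullet> w) + t * t * (2 * b * (w \<bullet> w))"
      using wMw by (intro add_left_mono mult_left_mono) auto
    also have "\<dots> = v \<bullet> (M *\<^sub>v v) - t * (w \<bullet> w)"
      using b(1) by (simp add: t_def field_simps)
    finally have "t * (w \<bullet> w) \<le> v \<bullet> (M *\<^sub>v v)" by simp
    moreover have "inverse (2 * b * c) * (v \<bullet> v) \<le> t * (w \<bullet> w)"
      using vw b(1) c(1) by (simp add: t_def field_simps)
    ultimately show ?thesis by simp
  qed
  with b(1) c(1) show ?thesis
    by (intro exI[of _ "inverse (2 * b * c)"]) auto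
qed

lemma negdef_mat_coercive:
  assumes "negdef_mat n M"
  shows "\<exists>e>0. \<forall>v\<in>carrier_vec n. v \<bullet> (M *\<^sub>v v) \<le> - e * (v \<bullet> v)"
proof -
  have M: "M \<in> carrier_mat n n" 
    using assms by (simp add: negdef_mat_def)
  have neg: "v \<bullet> ((- M) *\<^sub>v v) = - (v \<bullet> (M *\<^sub>v v))" if "v \<in> carrier_vec n" for v
    using that M by simp
  have "posdef_mat n (- M)"
    using assms neg by (auto simp: posdef_mat_def negdef_mat_def transpose_uminus)
  from posdef_mat_coercive[OF this] show ?thesis
    using neg by force
qed

section \<open>Componentwise calculus for vectors\<close>

definition has_vec_deriv :: "nat \<Rightarrow> (real \<Rightarrow> real vec) \<Rightarrow> real vec \<Rightarrow> real \<Rightarrow> bool" where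
  "has_vec_deriv n f f' t \<longleftrightarrow> (\<forall>i<n. ((\<lambda>s. f s $ i) has_real_derivative f' $ i) (at t))"

definition vec_cont_on :: "nat \<Rightarrow> real set \<Rightarrow> (real \<Rightarrow> real vec) \<Rightarrow> bool" where
  "vec_cont_on n U f \<longleftrightarrow> (\<forall>i<n. continuous_on U (\<lambda>t. f t $ i))"

lemma mult_mat_vec_index_sum:
  assumes "M \<in> carrier_mat n m" "v \<in> carrier_vec m" "i < n"
  shows "(M *\<^sub>v v) $ i = (\<Sum>j=0..<m. M $$ (i, j) * v $ j)"
  using assms by (simp add: scalar_prod_def)

lemma has_vec_deriv_mult_mat_vec:
  assumes "M \<in> carrier_mat n m" "\<And>s. f s \<in> carrier_vec m" "f' \<in> carrier_vec m" "has_vec_deriv m f f' t"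
  shows "has_vec_deriv n (\<lambda>s. M *\<^sub>v f s) (M *\<^sub>v f') t"
  using assms unfolding has_vec_deriv_def
  by (auto simp: mult_mat_vec_index_sum[OF assms(1)] simp del: index_mult_mat_vec intro!: DERIV_sum DERIV_cmult)

lemma has_real_derivative_scalar_prod:
  assumes "\<And>s. f s \<in> carrier_vec n" "\<And>s. g s \<in> carrier_vec n" "f' \<in> carrier_vec n" "g' \<in> carrier_vec n"
    and "has_vec_deriv n f f' t" "has_vec_deriv n g g' t"
  shows "((\<lambda>s. f s \<bullet> g s) has_real_derivative f' \<bullet> g t + f t \<bullet> g') (at t)"
proof -
  have "((\<lambda>s. \<Sum>i=0..<n. f s $ i * g s $ i) has_real_derivative
      (\<Sum>i=0..<n. f' $ i * g t $ i + f t $ i * g' $ i)) (at t)"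
    using assms(5,6) unfolding has_vec_deriv_def
    by (intro DERIV_sum) (auto intro!: derivative_eq_intros)
  thus ?thesis
    by (simp add: scalar_prod_def carrier_vecD[OF assms(2)] carrier_vecD[OF assms(4)] sum.distrib)
qed

lemma has_real_derivative_quadratic_form:
  assumes "M \<in> carrier_mat n n" "transpose_mat M = M" "\<And>s. f s \<in> carrier_vec n" "f' \<in> carrier_vec n"
    and "has_vec_deriv n f f' t"
  shows "((\<lambda>s. f s \<bullet> (M *\<^sub>v f s)) has_real_derivative 2 * (f t \<bullet> (M *\<^sub>v f'))) (at t)"
proof -
  have "((\<lambda>s. f s \<bullet> (M *\<^sub>v f s)) has_real_derivative f' \<bullet> (M *\<^sub>v f t) + f t \<bullet> (M *\<^sub>v f')) (at t)"
    using assms by (intro has_real_derivative_scalar_prod has_vec_deriv_mult_mat_vec) auto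
  thus ?thesis
    by (simp add: sym_mat_scalar_prod[OF assms(1,2,4,3)])
qed

lemma vec_cont_on_mult_mat_vec:
  assumes "M \<in> carrier_mat n m" "\<And>s. f s \<in> carrier_vec m" "vec_cont_on m U f"
  shows "vec_cont_on n U (\<lambda>s. M *\<^sub>v f s)"
  using assms unfolding vec_cont_on_def
  by (auto simp: mult_mat_vec_index_sum[OF assms(1)] simp del: index_mult_mat_vec intro!: continuous_intros)

lemma continuous_on_scalar_prod:
  assumes "\<And>s. g s \<in> carrier_vec n" "vec_cont_on n U f" "vec_cont_on n U g"
  shows "continuous_on U (\<lambda>s. f s \<bullet> g s)"
  using assms(2,3) unfolding vec_cont_on_def scalar_prod_def carrier_vecD[OF assms(1)]
  by (auto intro!: continuous_intros)

lemma continuous_on_quadratic_form: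
  assumes "M \<in> carrier_mat n n" "\<And>s. f s \<in> carrier_vec n" "vec_cont_on n U f"
  shows "continuous_on U (\<lambda>s. f s \<bullet> (M *\<^sub>v f s))"
  using assms by (intro continuous_on_scalar_prod vec_cont_on_mult_mat_vec) auto

section \<open>Block vectors and the quadratic form of \<open>\<Phi>\<^sub>N\<close>\<close>

text \<open>The numbering by \<open>div\<close> and \<open>mod\<close> is that of
  \<open>block_mat\<close>, which makes products of the two computable block by block.\<close>

definition block_vec :: "nat \<Rightarrow> nat \<Rightarrow> (nat \<Rightarrow> 'a vec) \<Rightarrow> 'a vec" where
  "block_vec n p f = vec (p * n) (\<lambda>i. f (i div n) $ (i mod n))"

lemma block_vec_carrier [simp]: "block_vec n p f \<in> carrier_vec (p * n)"
  by (simp add: block_vec_def)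

lemma block_index_less: "a < p \<Longrightarrow> i < n \<Longrightarrow> a * n + i < p * (n :: nat)"
proof -
  assume "a < p" "i < n"
  have "a * n + i < Suc a * n" using \<open>i < n\<close> by simp
  also have "\<dots> \<le> p * n" using \<open>a < p\<close> by (intro mult_le_mono1) simp
  finally show ?thesis .
qed

lemma block_vec_index: "a < p \<Longrightarrow> i < n \<Longrightarrow> block_vec n p f $ (a * n + i) = f a $ i"
  by (simp add: block_vec_def block_index_less)

lemma sum_blocks:
  fixes n p :: nat
  shows "(\<Sum>i=0..<p * n. g i) = (\<Sum>a<p. \<Sum>i<n. g (a * n + i))"
proof -
  have "(\<Sum>i=0..<p * n. g i) = (\<Sum>a<p. \<Sum>i=a * n..<a * n + n. g i)"
    unfolding atLeast0LessThan by (rule sum.nat_group[symmetric])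
  also have "\<dots> = (\<Sum>a<p. \<Sum>i<n. g (a * n + i))"
  proof (rule sum.cong[OF refl])
    fix a
    show "(\<Sum>i=a * n..<a * n + n. g i) = (\<Sum>i<n. g (a * n + i))"
      using sum.shift_bounds_nat_ivl[of g 0 "a * n" n] by (simp add: add.commute atLeast0LessThan)
  qed
  finally show ?thesis .
qed

lemma block_vec_eqI:
  assumes "v \<in> carrier_vec (p * n)" "\<And>a i. a < p \<Longrightarrow> i < n \<Longrightarrow> v $ (a * n + i) = f a $ i"
  shows "v = block_vec n p f"
proof (rule eq_vecI)
  fix i assume "i < dim_vec (block_vec n p f)"
  hence i: "i < p * n" by (simp add: block_vec_def)
  hence "n > 0" by (cases n) auto
  with i have "i div n < p" "i mod n < n"
    by (auto simp: less_mult_imp_div_less)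
  from assms(2)[OF this] show "v $ i = block_vec n p f $ i"
    using i by (simp add: block_vec_def)
qed (use assms(1) in \<open>simp add: block_vec_def\<close>)

lemma scalar_prod_block_vec:
  assumes "\<And>a. a < p \<Longrightarrow> g a \<in> carrier_vec n"
  shows "block_vec n p f \<bullet> block_vec n p g = (\<Sum>a<p. f a \<bullet> g a)"
proof -
  have "block_vec n p f \<bullet> block_vec n p g =
      (\<Sum>i=0..<p * n. block_vec n p f $ i * block_vec n p g $ i)"
    by (simp add: scalar_prod_def block_vec_def)
  also have "\<dots> = (\<Sum>a<p. \<Sum>i<n. f a $ i * g a $ i)"
    unfolding sum_blocks by (intro sum.cong) (auto simp: block_vec_index)
  also have "\<dots> = (\<Sum>a<p. f a \<bullet> g a)"
    by (intro sum.cong) (simp_all add: scalar_prod_def atLeast0LessThan carrier_vecD[OF assms])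
  finally show ?thesis .
qed

lemma block_mat_carrier [simp]: "block_mat r c p q F \<in> carrier_mat (p * r) (q * c)"
  by (simp add: block_mat_def)

lemma block_mat_mult_block_vec:
  assumes "\<And>a b. a < p \<Longrightarrow> b < q \<Longrightarrow> F a b \<in> carrier_mat r c" "\<And>b. b < q \<Longrightarrow> f b \<in> carrier_vec c"
  shows "block_mat r c p q F *\<^sub>v block_vec c q f = block_vec r p (\<lambda>a. vec r (\<lambda>i. \<Sum>b<q. (F a b *\<^sub>v f b) $ i))"
proof (rule block_vec_eqI)
  show "block_mat r c p q F *\<^sub>v block_vec c q f \<in> carrier_vec (p * r)"
    by (rule mult_mat_vec_carrier[of _ "p * r" "q * c"]) auto
next
  fix a i assume a: "a < p" and i: "i < r"
  have "(block_mat r c p q F *\<^sub>v block_vec c q f) $ (a * r + i) =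
      (\<Sum>j=0..<q * c. block_mat r c p q F $$ (a * r + i, j) * block_vec c q f $ j)"
    using a i by (intro mult_mat_vec_index_sum[of _ "p * r"] block_index_less) auto
  also have "\<dots> = (\<Sum>b<q. \<Sum>j<c. F a b $$ (i, j) * f b $ j)"
    unfolding sum_blocks using a i
    by (intro sum.cong) (auto simp: block_vec_index block_mat_def block_index_less)
  also have "\<dots> = (\<Sum>b<q. (F a b *\<^sub>v f b) $ i)"
    using assms a i by (intro sum.cong refl) (auto simp: mult_mat_vec_index_sum[of _ r c] atLeast0LessThan simp del: index_mult_mat_vec)
  finally show "(block_mat r c p q F *\<^sub>v block_vec c q f) $ (a * r + i) =
      vec r (\<lambda>i. \<Sum>b<q. (F a b *\<^sub>v f b) $ i) $ i"
    using i by simp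
qed

lemma block_vec_single:
  assumes "v \<in> carrier_vec n"
  shows "block_vec n 1 (\<lambda>_. v) = v"
  using assms by (intro block_vec_eqI[symmetric]) auto

lemma block_vec_cong:
  assumes "\<And>a. a < p \<Longrightarrow> f a = g a"
  shows "block_vec n p f = block_vec n p g"
  by (rule block_vec_eqI) (auto simp: block_vec_index assms)

lemma block_row_mult_block_vec:
  assumes "\<And>b. b < q \<Longrightarrow> F b \<in> carrier_mat n n" "\<And>b. b < q \<Longrightarrow> f b \<in> carrier_vec n"
  shows "block_mat n n 1 q (\<lambda>_. F) *\<^sub>v block_vec n q f = vec n (\<lambda>i. \<Sum>b<q. (F b *\<^sub>v f b) $ i)"
  using assms by (subst block_mat_mult_block_vec) (auto simp: block_vec_single simp del: One_nat_def)

lemma block_column_mult_vec: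
  assumes "\<And>a. a < p \<Longrightarrow> F a \<in> carrier_mat r c" "v \<in> carrier_vec c"
  shows "block_mat r c p 1 (\<lambda>a _. F a) *\<^sub>v v = block_vec r p (\<lambda>a. F a *\<^sub>v v)"
proof -
  have "block_mat r c p 1 (\<lambda>a _. F a) *\<^sub>v v = block_mat r c p 1 (\<lambda>a _. F a) *\<^sub>v block_vec c 1 (\<lambda>_. v)"
    using assms(2) by (simp only: block_vec_single)
  also have "\<dots> = block_vec r p (\<lambda>a. vec r (\<lambda>i. \<Sum>b<(1::nat). (F a *\<^sub>v v) $ i))"
    using assms by (subst block_mat_mult_block_vec) (auto simp del: index_mult_mat_vec simp: lessThan_Suc)
  also have "\<dots> = block_vec r p (\<lambda>a. F a *\<^sub>v v)"
  proof (rule block_vec_cong)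
    fix a assume "a < p"
    hence "F a \<in> carrier_mat r c" by (rule assms(1))
    thus "vec r (\<lambda>i. \<Sum>b<(1::nat). (F a *\<^sub>v v) $ i) = F a *\<^sub>v v"
      by (intro eq_vecI) auto
  qed
  finally show ?thesis .
qed

lemma block_vec_Suc:
  "block_vec n (Suc p) f = vec n (\<lambda>i. f 0 $ i) @\<^sub>v block_vec n p (\<lambda>a. f (Suc a))"
proof (rule block_vec_eqI[symmetric])
  fix a i assume a: "a < Suc p" and i: "i < n"
  show "(vec n (\<lambda>i. f 0 $ i) @\<^sub>v block_vec n p (\<lambda>a. f (Suc a))) $ (a * n + i) = f a $ i"
  proof (cases a)
    case 0
    thus ?thesis using i by (simp add: block_vec_def)
  next
    case (Suc b)
    with a i show ?thesis
      using block_vec_index[of b p i n "\<lambda>a. f (Suc a)"] block_index_less[of b p i n]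
      by (simp add: block_vec_def)
  qed
qed (auto simp: block_vec_def)

section \<open>Quadratic forms of block-diagonal matrices and congruences\<close>

lemma quadratic_form_diag_block_mat_Cons:
  fixes M :: "real mat"
  assumes "M \<in> carrier_mat n n" "diag_block_mat Ms \<in> carrier_mat k k" "v \<in> carrier_vec n" "w \<in> carrier_vec k"
  shows "(v @\<^sub>v w) \<bullet> (diag_block_mat (M # Ms) *\<^sub>v (v @\<^sub>v w)) = v \<bullet> (M *\<^sub>v v) + w \<bullet> (diag_block_mat Ms *\<^sub>v w)"
proof -
  have "diag_block_mat (M # Ms) *\<^sub>v (v @\<^sub>v w) = (M *\<^sub>v v) @\<^sub>v (diag_block_mat Ms *\<^sub>v w)"
    using assms by (simp add: Let_def mult_mat_vec_split)
  thus ?thesis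
    using assms by (simp add: scalar_prod_append[of _ n _ k])
qed

lemma diag_block_mat_carrier:
  "(\<And>M. M \<in> set Ms \<Longrightarrow> M \<in> carrier_mat n n) \<Longrightarrow> diag_block_mat Ms \<in> carrier_mat (length Ms * n) (length Ms * n)"
proof (induction Ms)
  case (Cons M Ms)
  hence "M \<in> carrier_mat n n" "diag_block_mat Ms \<in> carrier_mat (length Ms * n) (length Ms * n)"
    by auto
  thus ?case by (auto simp: Let_def)
qed auto

lemma quadratic_form_diag_block_mat:
  fixes Ms :: "real mat list"
  assumes "\<And>M. M \<in> set Ms \<Longrightarrow> M \<in> carrier_mat n n" "\<And>a. a < length Ms \<Longrightarrow> f a \<in> carrier_vec n"
  shows "block_vec n (length Ms) f \<bullet> (diag_block_mat Ms *\<^sub>v block_vec n (length Ms) f) =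
    (\<Sum>a<length Ms. f a \<bullet> ((Ms ! a) *\<^sub>v f a))"
  using assms
proof (induction Ms arbitrary: f)
  case Nil
  thus ?case by (simp add: scalar_prod_def block_vec_def)
next
  case (Cons M Ms)
  have f0: "vec n (\<lambda>i. f 0 $ i) = f 0"
    using Cons.prems(2)[of 0] by auto
  have "block_vec n (length (M # Ms)) f \<bullet> (diag_block_mat (M # Ms) *\<^sub>v block_vec n (length (M # Ms)) f) =
      f 0 \<bullet> (M *\<^sub>v f 0) + block_vec n (length Ms) (\<lambda>a. f (Suc a)) \<bullet>
        (diag_block_mat Ms *\<^sub>v block_vec n (length Ms) (\<lambda>a. f (Suc a)))"
    unfolding length_Cons block_vec_Suc f0 using Cons.prems
    by (intro quadratic_form_diag_block_mat_Cons[of _ n _ "length Ms * n"] diag_block_mat_carrier) auto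
  also have "\<dots> = f 0 \<bullet> (M *\<^sub>v f 0) + (\<Sum>a<length Ms. f (Suc a) \<bullet> ((Ms ! a) *\<^sub>v f (Suc a)))"
    using Cons.prems by (subst Cons.IH) auto
  finally show ?case
    by (simp only: length_Cons sum.lessThan_Suc_shift) simp
qed

lemma smult_mat_mult_vec:
  fixes M :: "real mat"
  assumes "M \<in> carrier_mat r c" "v \<in> carrier_vec c"
  shows "(k \<cdot>\<^sub>m M) *\<^sub>v v = k \<cdot>\<^sub>v (M *\<^sub>v v)"
  using assms by (intro eq_vecI) auto

lemma smult_one_mat_mult_vec:
  fixes v :: "real vec"
  assumes "v \<in> carrier_vec n"
  shows "(k \<cdot>\<^sub>m 1\<^sub>m n) *\<^sub>v v = k \<cdot>\<^sub>v v"
  using assms by (simp add: smult_mat_mult_vec[of _ n n])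

lemma quadratic_form_congruence:
  fixes M :: "real mat"
  assumes "G \<in> carrier_mat k n" "M \<in> carrier_mat k l" "H \<in> carrier_mat l n" "v \<in> carrier_vec n"
  shows "v \<bullet> ((transpose_mat G * M * H) *\<^sub>v v) = (G *\<^sub>v v) \<bullet> (M *\<^sub>v (H *\<^sub>v v))"
proof -
  have "(transpose_mat G * M * H) *\<^sub>v v = transpose_mat G *\<^sub>v (M *\<^sub>v (H *\<^sub>v v))"
    using assms assoc_mult_mat_vec[of "transpose_mat G * M" n l H n v]
      assoc_mult_mat_vec[of "transpose_mat G" n k M l "H *\<^sub>v v"] by auto
  also have "v \<bullet> \<dots> = (M *\<^sub>v (H *\<^sub>v v)) \<bullet> (G *\<^sub>v v)"
    using assms transpose_vec_mult_scalar[OF assms(1,4), of "M *\<^sub>v (H *\<^sub>v v)"]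
      comm_scalar_prod[of v n "transpose_mat G *\<^sub>v (M *\<^sub>v (H *\<^sub>v v))"]
      comm_scalar_prod[of "M *\<^sub>v (H *\<^sub>v v)" k "G *\<^sub>v v"] by auto
  finally show ?thesis
    using assms comm_scalar_prod[of "M *\<^sub>v (H *\<^sub>v v)" k "G *\<^sub>v v"] by auto
qed

lemma quadratic_form_He:
  assumes "M \<in> carrier_mat n n" "v \<in> carrier_vec n"
  shows "v \<bullet> (He M *\<^sub>v v) = 2 * (v \<bullet> (M *\<^sub>v v))"
proof -
  have "v \<bullet> (transpose_mat M *\<^sub>v v) = v \<bullet> (M *\<^sub>v v)"
    using transpose_vec_mult_scalar[OF assms assms(2)] assms
      comm_scalar_prod[of v n "transpose_mat M *\<^sub>v v"] by auto
  thus ?thesis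
    using assms by (simp add: He_def add_mult_distrib_mat_vec[of _ n n] scalar_prod_add_distrib[of _ n])
qed

lemma sum_blocks_N3:
  fixes N :: nat
  shows "(\<Sum>b<N + 3. f b) = f 0 + f 1 + f 2 + (\<Sum>k<N. f (k + 3) :: real)"
  by (simp add: numeral_3_eq_3 numeral_2_eq_2 sum.lessThan_Suc_shift del: sum.lessThan_Suc)

text \<open>In \<open>xi_vec n N w z zd \<mu>\<close> the arguments stand for the derivative of the state, the state, the delayed
  state and the Legendre moments.\<close>

definition xi_vec :: "nat \<Rightarrow> nat \<Rightarrow> real vec \<Rightarrow> real vec \<Rightarrow> real vec \<Rightarrow> (nat \<Rightarrow> real vec) \<Rightarrow> real vec" where
  "xi_vec n N w z zd \<mu> =
     block_vec n (N + 3) (\<lambda>b. if b = 0 then w else if b = 1 then z else if b = 2 then zd else \<mu> (b - 3))"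

text \<open>The product of \<open>Gamma_mat\<close> with \<open>xi_vec\<close>, written out. The
  derivative block does not appear because the first block column of \<open>Gamma_mat\<close> is
  zero.\<close>

definition Gamma_vec :: "nat \<Rightarrow> nat \<Rightarrow> real vec \<Rightarrow> real vec \<Rightarrow> (nat \<Rightarrow> real vec) \<Rightarrow> nat \<Rightarrow> real vec" where
  "Gamma_vec n N z zd \<mu> q =
     vec n (\<lambda>i. z $ i + (-1) ^ (q + 1) * zd $ i + (\<Sum>k<N. gamma_coeff q k * \<mu> k $ i))"

lemma Gamma_vec_carrier [simp]: "Gamma_vec n N z zd \<mu> q \<in> carrier_vec n"
  by (simp add: Gamma_vec_def)

section \<open>The matrices of the LMI applied to an arbitrary block vector\<close>

context
  fixes n N :: nat and w z zd :: "real vec" and \<mu> :: "nat \<Rightarrow> real vec"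
  assumes carr: "w \<in> carrier_vec n" "z \<in> carrier_vec n" "zd \<in> carrier_vec n"
    "\<And>k. k < N \<Longrightarrow> \<mu> k \<in> carrier_vec n"
begin

abbreviation "\<xi> \<equiv> xi_vec n N w z zd \<mu>"

abbreviation "\<xi>_block b \<equiv> (if b = 0 then w else if b = 1 then z else if b = 2 then zd else \<mu> (b - 3))"

lemma xi_carrier [simp]: "\<xi> \<in> carrier_vec ((N + 3) * n)"
  unfolding xi_vec_def by (rule block_vec_carrier)

lemma xi_block_carrier: "b < N + 3 \<Longrightarrow> \<xi>_block b \<in> carrier_vec n"
  using carr by auto

lemma Gamma_mat_mult_xi: "Gamma_mat n N q *\<^sub>v \<xi> = Gamma_vec n N z zd \<mu> q"
proof -
  have "Gamma_mat n N q *\<^sub>v \<xi> = vec n (\<lambda>i. \<Sum>b<N + 3. (((if b = 0 then 0\<^sub>m n n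
     else if b = 1 then 1\<^sub>m n
     else if b = 2 then (-1) ^ (q + 1) \<cdot>\<^sub>m 1\<^sub>m n
     else gamma_coeff q (b - 3) \<cdot>\<^sub>m 1\<^sub>m n) *\<^sub>v \<xi>_block b) $ i))"
    unfolding Gamma_mat_def xi_vec_def using xi_block_carrier
    by (intro block_row_mult_block_vec) auto
  also have "\<dots> = Gamma_vec n N z zd \<mu> q"
    using carr unfolding sum_blocks_N3 Gamma_vec_def
    by (intro eq_vecI) (simp_all add: smult_one_mat_mult_vec carrier_vecD[OF carr(4)])
  finally show ?thesis .
qed

lemma F_mat_mult_xi: "F_mat n N *\<^sub>v \<xi> = w"
proof -
  have "F_mat n N *\<^sub>v \<xi> = vec n (\<lambda>i. \<Sum>b<N + 3. ((if b = 0 then 1\<^sub>m n else 0\<^sub>m n n) *\<^sub>v \<xi>_block b) $ i)"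
    unfolding F_mat_def xi_vec_def using xi_block_carrier
    by (intro block_row_mult_block_vec) auto
  also have "\<dots> = w"
    using carr unfolding sum_blocks_N3 by (intro eq_vecI) simp_all
  finally show ?thesis .
qed

lemma H_mat_mult_xi:
  "H_mat n N *\<^sub>v \<xi> = block_vec n (N + 1) (\<lambda>a. if a = 0 then w else Gamma_vec n N z zd \<mu> (a - 1))"
proof -
  have "F_mat n N \<in> carrier_mat (1 * n) ((N + 3) * n)" "Gamma_mat n N q \<in> carrier_mat (1 * n) ((N + 3) * n)" for q
    unfolding F_mat_def Gamma_mat_def by (rule block_mat_carrier)+
  hence "H_mat n N *\<^sub>v \<xi> =
      block_vec n (N + 1) (\<lambda>a. (if a = 0 then F_mat n N else Gamma_mat n N (a - 1)) *\<^sub>v \<xi>)"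
    unfolding H_mat_def by (intro block_column_mult_vec) auto
  also have "\<dots> = block_vec n (N + 1) (\<lambda>a. if a = 0 then w else Gamma_vec n N z zd \<mu> (a - 1))"
    by (intro block_vec_cong) (simp add: F_mat_mult_xi Gamma_mat_mult_xi)
  finally show ?thesis .
qed

lemma Gamma_stack_mult_xi: "Gamma_stack n N *\<^sub>v \<xi> = block_vec n (N + 1) (Gamma_vec n N z zd \<mu>)"
proof -
  have "Gamma_mat n N q \<in> carrier_mat (1 * n) ((N + 3) * n)" for q
    unfolding Gamma_mat_def by (rule block_mat_carrier)
  hence "Gamma_stack n N *\<^sub>v \<xi> = block_vec n (N + 1) (\<lambda>q. Gamma_mat n N q *\<^sub>v \<xi>)"
    unfolding Gamma_stack_def by (intro block_column_mult_vec) auto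
  thus ?thesis
    by (simp only: Gamma_mat_mult_xi)
qed

text \<open>Along a solution this is the extended state, and \<open>H_mat_mult_xi\<close> gives its
  time derivative; hence the \<open>He\<close> term of \<open>Phi_mat\<close> is the derivative of
  the quadratic part of the functional.\<close>

lemma G_mat_mult_xi:
  "G_mat n N h *\<^sub>v \<xi> = block_vec n (N + 1) (\<lambda>a. if a = 0 then z else h \<cdot>\<^sub>v \<mu> (a - 1))"
proof -
  let ?F = "\<lambda>a b. if a = 0 \<and> b = 1 then 1\<^sub>m n else if a \<ge> 1 \<and> b = a + 2 then h \<cdot>\<^sub>m 1\<^sub>m n else 0\<^sub>m n n"
  have "G_mat n N h *\<^sub>v \<xi> = block_vec n (N + 1) (\<lambda>a. vec n (\<lambda>i. \<Sum>b<N + 3. (?F a b *\<^sub>v \<xi>_block b) $ i))"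
    unfolding G_mat_def xi_vec_def using xi_block_carrier
    by (intro block_mat_mult_block_vec) auto
  also have "\<dots> = block_vec n (N + 1) (\<lambda>a. if a = 0 then z else h \<cdot>\<^sub>v \<mu> (a - 1))"
  proof (rule block_vec_cong)
    fix a assume a: "a < N + 1"
    show "vec n (\<lambda>i. \<Sum>b<N + 3. (?F a b *\<^sub>v \<xi>_block b) $ i) = (if a = 0 then z else h \<cdot>\<^sub>v \<mu> (a - 1))"
    proof (cases a)
      case 0
      thus ?thesis
        using carr unfolding sum_blocks_N3 by (intro eq_vecI) simp_all
    next
      case (Suc k)
      with a have k: "k < N" by simp
      \<comment> \<open>Block row a = k + 1 has its only nonzero block in column a + 2 = k + 3, the
        place of the k-th moment.\<close>
      have s: "(\<Sum>j<N. (?F a (j + 3) *\<^sub>v \<xi>_block (j + 3)) $ i) = (\<Sum>j<N. if j = k then h * \<mu> k $ i else 0)"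
        if "i < n" for i
        using that Suc carr by (intro sum.cong) (auto simp: smult_one_mat_mult_vec carrier_vecD[OF carr(4)])
      have "(\<Sum>b<N + 3. (?F a b *\<^sub>v \<xi>_block b) $ i) = (h \<cdot>\<^sub>v \<mu> k) $ i" if "i < n" for i
        unfolding sum_blocks_N3 s[OF that] using that Suc carr k
        by (simp add: carrier_vecD[OF carr(4)])
      with k Suc show ?thesis
        by (intro eq_vecI) (simp_all add: carrier_vecD[OF carr(4)] del: index_mult_mat_vec)
    qed
  qed
  finally show ?thesis .
qed

lemma M_mat_mult_xi:
  assumes "A \<in> carrier_mat n n"
  shows "M_mat n N A *\<^sub>v \<xi> = w - A *\<^sub>v z"
proof -
  have "M_mat n N A *\<^sub>v \<xi> = vec n (\<lambda>i. \<Sum>b<N + 3.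
     ((if b = 0 then 1\<^sub>m n else if b = 1 then - A else 0\<^sub>m n n) *\<^sub>v \<xi>_block b) $ i)"
    unfolding M_mat_def xi_vec_def using xi_block_carrier assms
    by (intro block_row_mult_block_vec) auto
  also have "\<dots> = w - A *\<^sub>v z"
    using carr assms unfolding sum_blocks_N3 by (intro eq_vecI) simp_all
  finally show ?thesis .
qed

lemma delayed_mat_mult_xi:
  assumes "X \<in> carrier_mat n n"
  shows "delayed_mat n N X *\<^sub>v \<xi> = X *\<^sub>v zd"
proof -
  have "delayed_mat n N X *\<^sub>v \<xi> = vec n (\<lambda>i. \<Sum>b<N + 3. ((if b = 2 then X else 0\<^sub>m n n) *\<^sub>v \<xi>_block b) $ i)"
    unfolding delayed_mat_def xi_vec_def using xi_block_carrier assms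
    by (intro block_row_mult_block_vec) auto
  also have "\<dots> = X *\<^sub>v zd"
    using carr assms unfolding sum_blocks_N3 by (intro eq_vecI) simp_all
  finally show ?thesis .
qed

text \<open>The last diagonal block has size N n instead of n, so the blocks are peeled off one at a
  time rather than by the rule for blocks of equal size.\<close>

lemma S_tilde_form:
  assumes "S \<in> carrier_mat n n"
  shows "S_tilde n N S \<in> carrier_mat ((N + 3) * n) ((N + 3) * n)"
    and "\<xi> \<bullet> (S_tilde n N S *\<^sub>v \<xi>) = z \<bullet> (S *\<^sub>v z) - zd \<bullet> (S *\<^sub>v zd)"
proof -
  let ?Z = "0\<^sub>m (N * n) (N * n) :: real mat"
  have Z: "diag_block_mat [?Z] = ?Z"
    by (rule eq_matI) (auto simp: Let_def)
  have c1: "diag_block_mat [- S, ?Z] \<in> carrier_mat (n + N * n) (n + N * n)"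
    using assms by (simp add: Let_def)
  have c2: "diag_block_mat [S, - S, ?Z] \<in> carrier_mat (n + (n + N * n)) (n + (n + N * n))"
    using assms by (simp add: Let_def)
  show "S_tilde n N S \<in> carrier_mat ((N + 3) * n) ((N + 3) * n)"
  proof -
    have "(N + 3) * n = n + (n + (n + N * n))" by (simp add: algebra_simps)
    thus ?thesis using assms by (simp add: S_tilde_def Let_def)
  qed
  have "\<xi> = w @\<^sub>v (z @\<^sub>v (zd @\<^sub>v block_vec n N \<mu>))"
  proof -
    have "vec n (\<lambda>i. w $ i) = w" "vec n (\<lambda>i. z $ i) = z" "vec n (\<lambda>i. zd $ i) = zd"
      using carr by auto
    thus ?thesis
      by (simp add: xi_vec_def numeral_3_eq_3 numeral_2_eq_2 block_vec_Suc)
  qed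
  moreover have "(w @\<^sub>v (z @\<^sub>v (zd @\<^sub>v block_vec n N \<mu>))) \<bullet> (S_tilde n N S *\<^sub>v (w @\<^sub>v (z @\<^sub>v (zd @\<^sub>v block_vec n N \<mu>))))
      = w \<bullet> (0\<^sub>m n n *\<^sub>v w) + (z \<bullet> (S *\<^sub>v z) + (zd \<bullet> ((- S) *\<^sub>v zd)
        + block_vec n N \<mu> \<bullet> (diag_block_mat [?Z] *\<^sub>v block_vec n N \<mu>)))"
    unfolding S_tilde_def using carr assms c1 c2 Z
    by (simp add: quadratic_form_diag_block_mat_Cons[of _ n _ "n + (n + N * n)"]
       quadratic_form_diag_block_mat_Cons[of _ n _ "n + N * n"] 
       quadratic_form_diag_block_mat_Cons[of _ n _ "N * n"] del: diag_block_mat.simps)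
  moreover have "v \<bullet> (0\<^sub>m k k *\<^sub>v v) = 0" if "v \<in> carrier_vec k" for v :: "real vec" and k
  proof -
    have "0\<^sub>m k k *\<^sub>v v = 0\<^sub>v k"
      using that by (intro eq_vecI) auto
    thus ?thesis using that by simp
  qed
  ultimately show "\<xi> \<bullet> (S_tilde n N S *\<^sub>v \<xi>) = z \<bullet> (S *\<^sub>v z) - zd \<bullet> (S *\<^sub>v zd)"
    using carr assms unfolding Z by simp
qed

lemma R_diag_carrier:
  assumes "R \<in> carrier_mat n n"
  shows "R_diag N R \<in> carrier_mat ((N + 1) * n) ((N + 1) * n)"
proof -
  let ?L = "map (\<lambda>i. (2 * real i + 1) \<cdot>\<^sub>m R) [0..<N + 1]"
  have "diag_block_mat ?L \<in> carrier_mat (length ?L * n) (length ?L * n)"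
    by (rule diag_block_mat_carrier) (use assms in auto)
  thus ?thesis
    unfolding R_diag_def by (simp only: length_map length_upt diff_zero)
qed

lemma R_diag_form:
  assumes "R \<in> carrier_mat n n" "\<And>q. q \<le> N \<Longrightarrow> f q \<in> carrier_vec n"
  shows "block_vec n (N + 1) f \<bullet> (R_diag N R *\<^sub>v block_vec n (N + 1) f) =
    (\<Sum>q\<le>N. (2 * real q + 1) * (f q \<bullet> (R *\<^sub>v f q)))"
proof -
  let ?L = "map (\<lambda>i. (2 * real i + 1) \<cdot>\<^sub>m R) [0..<N + 1]"
  have "block_vec n (length ?L) f \<bullet> (diag_block_mat ?L *\<^sub>v block_vec n (length ?L) f) =
      (\<Sum>a<length ?L. f a \<bullet> ((?L ! a) *\<^sub>v f a))"
    using assms by (intro quadratic_form_diag_block_mat) auto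
  moreover have "length ?L = N + 1" by simp
  moreover have "(\<Sum>a<N + 1. f a \<bullet> ((?L ! a) *\<^sub>v f a)) = (\<Sum>q<N + 1. (2 * real q + 1) * (f q \<bullet> (R *\<^sub>v f q)))"
    using assms by (intro sum.cong refl) (auto simp: smult_mat_mult_vec[OF assms(1)] nth_append)
  ultimately show ?thesis
    unfolding R_diag_def by (simp only: lessThan_Suc_atMost[symmetric] Suc_eq_plus1)
qed

lemma Phi_mat_form:
  assumes P: "P \<in> carrier_mat ((N + 1) * n) ((N + 1) * n)" and S: "S \<in> carrier_mat n n" and R: "R \<in> carrier_mat n n"
  shows "Phi_mat n N h P S R \<in> carrier_mat ((N + 3) * n) ((N + 3) * n)"
    and "\<xi> \<bullet> (Phi_mat n N h P S R *\<^sub>v \<xi>) =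
      2 * (block_vec n (N + 1) (\<lambda>a. if a = 0 then z else h \<cdot>\<^sub>v \<mu> (a - 1)) \<bullet>
        (P *\<^sub>v block_vec n (N + 1) (\<lambda>a. if a = 0 then w else Gamma_vec n N z zd \<mu> (a - 1))))
      + z \<bullet> (S *\<^sub>v z) - zd \<bullet> (S *\<^sub>v zd) + h\<^sup>2 * (w \<bullet> (R *\<^sub>v w))
      - (\<Sum>q\<le>N. (2 * real q + 1) * (Gamma_vec n N z zd \<mu> q \<bullet> (R *\<^sub>v Gamma_vec n N z zd \<mu> q)))"
proof -
  let ?d = "(N + 3) * n" and ?e = "(N + 1) * n"
  define X Y Z where "X = transpose_mat (G_mat n N h) * P * H_mat n N"
    and "Y = transpose_mat (F_mat n N) * R * F_mat n N"
    and "Z = transpose_mat (Gamma_stack n N) * R_diag N R * Gamma_stack n N"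
  have G: "G_mat n N h \<in> carrier_mat ?e ?d"
    unfolding G_mat_def by (rule block_mat_carrier)
  have H: "H_mat n N \<in> carrier_mat ?e ?d"
    unfolding H_mat_def by (rule block_mat_carrier[of n _ _ 1, unfolded mult_1])
  have F: "F_mat n N \<in> carrier_mat n ?d"
    unfolding F_mat_def by (rule block_mat_carrier[of n n 1, unfolded mult_1])
  have K: "Gamma_stack n N \<in> carrier_mat ?e ?d"
    unfolding Gamma_stack_def by (rule block_mat_carrier[of n _ _ 1, unfolded mult_1])
  have XYZ: "X \<in> carrier_mat ?d ?d" "Y \<in> carrier_mat ?d ?d" "Z \<in> carrier_mat ?d ?d" "He X \<in> carrier_mat ?d ?d"
    unfolding X_def Y_def Z_def He_def using G H F K P R R_diag_carrier[OF R] by auto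
  note S' = S_tilde_form[OF S]
  have Phi: "Phi_mat n N h P S R = He X + S_tilde n N S + h\<^sup>2 \<cdot>\<^sub>m Y - Z"
    by (simp only: Phi_mat_def X_def Y_def Z_def)
  show "Phi_mat n N h P S R \<in> carrier_mat ?d ?d"
    unfolding Phi using XYZ by auto
  have "\<xi> \<bullet> (Phi_mat n N h P S R *\<^sub>v \<xi>) =
      \<xi> \<bullet> (He X *\<^sub>v \<xi>) + \<xi> \<bullet> (S_tilde n N S *\<^sub>v \<xi>) + h\<^sup>2 * (\<xi> \<bullet> (Y *\<^sub>v \<xi>)) - \<xi> \<bullet> (Z *\<^sub>v \<xi>)"
    unfolding Phi using XYZ S'(1) xi_carrier
    by (simp add: minus_mult_distrib_mat_vec[of _ ?d ?d] add_mult_distrib_mat_vec[of _ ?d ?d] smult_mat_mult_vec[of _ ?d ?d]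
        scalar_prod_minus_distrib[of _ ?d] scalar_prod_add_distrib[of _ ?d] del: xi_carrier)
  also have "\<xi> \<bullet> (He X *\<^sub>v \<xi>) = 2 * ((G_mat n N h *\<^sub>v \<xi>) \<bullet> (P *\<^sub>v (H_mat n N *\<^sub>v \<xi>)))"
    unfolding quadratic_form_He[OF XYZ(1) xi_carrier] unfolding X_def
    by (subst quadratic_form_congruence[OF G P H xi_carrier]) simp
  also have "\<xi> \<bullet> (Y *\<^sub>v \<xi>) = (F_mat n N *\<^sub>v \<xi>) \<bullet> (R *\<^sub>v (F_mat n N *\<^sub>v \<xi>))"
    unfolding Y_def by (rule quadratic_form_congruence[OF F R F xi_carrier])
  also have "\<xi> \<bullet> (Z *\<^sub>v \<xi>) = (Gamma_stack n N *\<^sub>v \<xi>) \<bullet> (R_diag N R *\<^sub>v (Gamma_stack n N *\<^sub>v \<xi>))"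
    unfolding Z_def by (rule quadratic_form_congruence[OF K R_diag_carrier[OF R] K xi_carrier])
  finally show "\<xi> \<bullet> (Phi_mat n N h P S R *\<^sub>v \<xi>) =
      2 * (block_vec n (N + 1) (\<lambda>a. if a = 0 then z else h \<cdot>\<^sub>v \<mu> (a - 1)) \<bullet>
        (P *\<^sub>v block_vec n (N + 1) (\<lambda>a. if a = 0 then w else Gamma_vec n N z zd \<mu> (a - 1))))
      + z \<bullet> (S *\<^sub>v z) - zd \<bullet> (S *\<^sub>v zd) + h\<^sup>2 * (w \<bullet> (R *\<^sub>v w))
      - (\<Sum>q\<le>N. (2 * real q + 1) * (Gamma_vec n N z zd \<mu> q \<bullet> (R *\<^sub>v Gamma_vec n N z zd \<mu> q)))"
    by (simp only: G_mat_mult_xi H_mat_mult_xi F_mat_mult_xi Gamma_stack_mult_xi S'(2) R_diag_form[OF R Gamma_vec_carrier] add_diff_eq)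
qed

text \<open>The hypothesis \<open>zero\<close> says that \<xi> lies in the kernel of the left factor
  L. Moving L across the scalar product turns the form into (W \<xi>) \<bullet> (L \<xi>), which
  vanishes whatever the multiplier W is: the elementary direction of Finsler's lemma.\<close>

lemma slack_form_zero:
  assumes A: "A \<in> carrier_mat n n" and X: "X \<in> carrier_mat n n" and W: "W \<in> carrier_mat n ((N + 3) * n)"
    and zero: "\<sigma> \<cdot>\<^sub>v (w - A *\<^sub>v z) + X *\<^sub>v zd = 0\<^sub>v n"
  defines "Q \<equiv> He (transpose_mat (\<sigma> \<cdot>\<^sub>m M_mat n N A + delayed_mat n N X) * W)"
  shows "Q \<in> carrier_mat ((N + 3) * n) ((N + 3) * n)" and "\<xi> \<bullet> (Q *\<^sub>v \<xi>) = 0"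
proof -
  let ?d = "(N + 3) * n"
  define L where "L = \<sigma> \<cdot>\<^sub>m M_mat n N A + delayed_mat n N X"
  have MD: "M_mat n N A \<in> carrier_mat n ?d" "delayed_mat n N X \<in> carrier_mat n ?d"
    unfolding M_mat_def delayed_mat_def by (rule block_mat_carrier[of n n 1, unfolded mult_1])+
  hence L: "L \<in> carrier_mat n ?d" by (simp add: L_def)
  have c: "transpose_mat L * W \<in> carrier_mat ?d ?d"
    using L W by auto
  show "Q \<in> carrier_mat ?d ?d"
    using c unfolding Q_def He_def L_def by auto
  have "L *\<^sub>v \<xi> = \<sigma> \<cdot>\<^sub>v (M_mat n N A *\<^sub>v \<xi>) + delayed_mat n N X *\<^sub>v \<xi>"
    unfolding L_def using MD xi_carrier
    by (simp add: add_mult_distrib_mat_vec[of _ n ?d] smult_mat_mult_vec[of _ n ?d] del: xi_carrier)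
  also have "\<dots> = 0\<^sub>v n"
    by (simp only: M_mat_mult_xi[OF A] delayed_mat_mult_xi[OF X] zero)
  finally have Lxi: "L *\<^sub>v \<xi> = 0\<^sub>v n" .
  have "(transpose_mat L * W) *\<^sub>v \<xi> = transpose_mat L *\<^sub>v (W *\<^sub>v \<xi>)"
    using L W xi_carrier by (intro assoc_mult_mat_vec) auto
  hence "\<xi> \<bullet> ((transpose_mat L * W) *\<^sub>v \<xi>) = (W *\<^sub>v \<xi>) \<bullet> (L *\<^sub>v \<xi>)"
    using transpose_vec_mult_scalar[OF L xi_carrier, of "W *\<^sub>v \<xi>"] W L xi_carrier
      comm_scalar_prod[of \<xi> ?d "transpose_mat L *\<^sub>v (W *\<^sub>v \<xi>)"] by (auto simp del: xi_carrier)
  also have "\<dots> = 0"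
    unfolding Lxi using W xi_carrier by (intro scalar_prod_right_zero) auto
  finally show "\<xi> \<bullet> (Q *\<^sub>v \<xi>) = 0"
    unfolding Q_def by (subst quadratic_form_He) (use c xi_carrier in \<open>auto simp flip: L_def\<close>)
qed

end

section \<open>Analytic ingredients\<close>

lemma ex_primitive:
  fixes f :: "real \<Rightarrow> real"
  assumes "continuous_on {a..} f"
  shows "\<exists>F. \<forall>t>a. (F has_real_derivative f t) (at t)"
proof (intro exI allI impI)
  fix t assume t: "t > a"
  have "((\<lambda>x. integral {a..x} f) has_real_derivative f t) (at t within {a..t + 1})"
    using t continuous_on_subset[OF assms] by (intro integral_has_real_derivative) auto
  moreover have "at t within {a..t + 1} = at t"
    using t by (intro at_within_interior) auto
  ultimately show "((\<lambda>x. integral {a..x} f) has_real_derivative f t) (at t)"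
    by simp
qed

text \<open>V decreases and is bounded below, so after some time T less than a fixed amount of
  decrease is left. If g were at least r at a later time, the bound on g' would keep it above r/2
  for a time \<tau>, and V would have to lose more than what is left.\<close>

lemma barbalat_dissipation:
  fixes V g V' g' :: "real \<Rightarrow> real"
  assumes V: "\<And>t. t > a \<Longrightarrow> (V has_real_derivative V' t) (at t)" "\<And>t. t > a \<Longrightarrow> V' t \<le> - e * g t"
      "\<And>t. t > a \<Longrightarrow> 0 \<le> V t" "e > 0"
    and g: "\<And>t. t > a \<Longrightarrow> (g has_real_derivative g' t) (at t)" "\<And>t. t > a \<Longrightarrow> \<bar>g' t\<bar> \<le> M"
      "\<And>t. t > a \<Longrightarrow> 0 \<le> g t"
  shows "(g \<longlongrightarrow> 0) at_top"
proof (rule tendstoI)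
  fix r :: real assume r: "r > 0"
  define K where "K = max M 1"
  \<comment> \<open>The longest time in which g, moving at speed at most K, changes by no more than
    r/2. Taking K at least 1 makes the division safe.\<close>
  define \<tau> where "\<tau> = r / (2 * K)"
  have K: "K > 0" "M \<le> K" by (auto simp: K_def)
  have \<tau>: "\<tau> > 0" "K * \<tau> = r / 2" using r K by (auto simp: \<tau>_def)
  define l where "l = Inf (V ` {a<..})"
  have bdd: "bdd_below (V ` {a<..})"
    using V(3) by (intro bdd_belowI[of _ 0]) auto
  have l: "l \<le> V t" if "t > a" for t
    unfolding l_def using that by (intro cInf_lower bdd) auto
  have "Inf (V ` {a<..}) < l + e * \<tau> * (r / 2)"
    using V(4) \<tau> r by (simp add: l_def)
  then obtain T where T: "T > a" "V T < l + e * \<tau> * (r / 2)"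
    by (subst (asm) cInf_less_iff[OF _ bdd]) auto
  have decr: "V t \<le> V T" if "t \<ge> T" for t
  proof (rule deriv_nonpos_imp_antimono[of T t V V'])
    fix x assume "x \<in> {T..t}"
    hence "x > a" using T by auto
    with V(2)[OF this] g(3)[OF this] V(4) show "V' x \<le> 0"
      by (auto intro: order.trans[of _ "- e * g x"])
  qed (use that T V(1) in auto)
  have "g t < r" if t: "t \<ge> T" for t
  proof (rule ccontr)
    assume "\<not> g t < r"
    \<comment> \<open>The mean value theorem replaces integration of V': one point x with g x \<ge>
      r/2 suffices, and a second application on [t, x] provides that bound.\<close>
    obtain x where x: "t < x" "x < t + \<tau>" "V (t + \<tau>) - V t = (t + \<tau> - t) * V' x"
      using MVT2[of t "t + \<tau>" V V'] \<tau> t T V(1) by auto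
    obtain y where y: "t < y" "y < x" "g x - g t = (x - t) * g' y"
      using MVT2[of t x g g'] x t T g(1) by auto
    have "y > a" "x > a" using y x t T by auto
    have "\<bar>g x - g t\<bar> \<le> \<tau> * K"
      unfolding y(3) abs_mult using x g(2)[OF \<open>y > a\<close>] K by (intro mult_mono) auto
    hence "\<bar>g x - g t\<bar> \<le> r / 2"
      using \<tau>(2) by (simp add: mult.commute)
    hence "r / 2 \<le> g x"
      using \<open>\<not> g t < r\<close> by linarith
    hence "e * (r / 2) \<le> e * g x"
      using V(4) by (intro mult_left_mono) auto
    hence "V' x \<le> - e * (r / 2)"
      using V(2)[OF \<open>x > a\<close>] by linarith
    hence "V (t + \<tau>) - V t \<le> \<tau> * (- e * (r / 2))"
      unfolding x(3) add_diff_cancel_left' using \<tau>(1) by (intro mult_left_mono) auto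
    moreover have "l \<le> V (t + \<tau>)"
      using t T \<tau> by (intro l) auto
    ultimately show False
      using decr[OF t] T(2) by (simp add: mult_ac)
  qed
  thus "\<forall>\<^sub>F t in at_top. dist (g t) 0 < r"
    using g(3) T(1) by (intro eventually_at_top_linorderI[of T]) auto
qed

section \<open>Legendre coefficients, Bessel's inequality and derivatives of moments\<close>

definition legendre_coeff :: "nat \<Rightarrow> (real \<Rightarrow> real vec) \<Rightarrow> nat \<Rightarrow> real vec" where
  "legendre_coeff n f k = vec n (\<lambda>i. integral {0..1} (\<lambda>u. poly (legendre k) u * f u $ i))"

lemma legendre_coeff_carrier [simp]: "legendre_coeff n f k \<in> carrier_vec n"
  by (simp add: legendre_coeff_def)

lemma has_integral_legendre_scalar_prod:
  assumes "vec_cont_on n {0..1} f" "v \<in> carrier_vec n"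
  shows "((\<lambda>u. poly (legendre k) u * (f u \<bullet> v)) has_integral legendre_coeff n f k \<bullet> v) {0..1}"
proof -
  have "((\<lambda>u. poly (legendre k) u * f u $ i) has_integral legendre_coeff n f k $ i) {0..1}" if "i < n" for i
    using that assms(1) unfolding vec_cont_on_def legendre_coeff_def
    by (auto intro!: integrable_integral integrable_continuous_real continuous_intros)
  hence "((\<lambda>u. \<Sum>i=0..<n. (poly (legendre k) u * f u $ i) * v $ i) has_integral
      (\<Sum>i=0..<n. legendre_coeff n f k $ i * v $ i)) {0..1}"
    by (intro has_integral_sum has_integral_mult_left) auto
  thus ?thesis
    using assms(2) by (simp add: scalar_prod_def sum_distrib_left mult.assoc)
qed

text \<open>Integrate the form \<open>R\<close> on the difference of \<open>f\<close> and its Legendre projection.\<close>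

lemma bessel_legendre:
  assumes R: "posdef_mat n R" and f: "\<And>u. f u \<in> carrier_vec n" and cont: "vec_cont_on n {0..1} f"
  shows "(\<Sum>q\<le>N. (2 * real q + 1) * (legendre_coeff n f q \<bullet> (R *\<^sub>v legendre_coeff n f q)))
    \<le> integral {0..1} (\<lambda>u. f u \<bullet> (R *\<^sub>v f u))"
proof -
  have Rc: "R \<in> carrier_mat n n" and Rs: "transpose_mat R = R"
    using R by (auto simp: posdef_mat_def)
  note sym = sym_mat_scalar_prod[OF Rc Rs]
  let ?c = "legendre_coeff n f"
  \<comment> \<open>The factor 2q + 1 is the inverse of the squared norm of
    \<open>legendre q\<close>; with it, s is the orthogonal projection of f onto the polynomials of
    degree at most N.\<close>
  define a where "a q u = (2 * real q + 1) * poly (legendre q) u" for q u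
  define s where "s u = vec n (\<lambda>i. \<Sum>q\<le>N. a q u * ?c q $ i)" for u
  define E where "E = (\<Sum>q\<le>N. (2 * real q + 1) * (?c q \<bullet> (R *\<^sub>v ?c q)))"
  have s: "s u \<in> carrier_vec n" for u by (simp add: s_def)
  have s_prod: "s u \<bullet> v = (\<Sum>q\<le>N. a q u * (?c q \<bullet> v))" if "v \<in> carrier_vec n" for u v
  proof -
    have "s u \<bullet> v = (\<Sum>i=0..<n. \<Sum>q\<le>N. a q u * (?c q $ i * v $ i))"
      using that by (simp add: s_def scalar_prod_def sum_distrib_right mult.assoc)
    also have "\<dots> = (\<Sum>q\<le>N. \<Sum>i=0..<n. a q u * (?c q $ i * v $ i))"
      by (rule sum.swap)
    finally show ?thesis
      using that by (simp add: scalar_prod_def sum_distrib_left)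
  qed
  have s_form: "s u \<bullet> (R *\<^sub>v v) = (\<Sum>q\<le>N. a q u * (v \<bullet> (R *\<^sub>v ?c q)))" if "v \<in> carrier_vec n" for u v
    using that Rc by (subst s_prod) (auto simp: sym[OF _ that])
  have expand: "(f u - s u) \<bullet> (R *\<^sub>v (f u - s u)) =
      f u \<bullet> (R *\<^sub>v f u) - 2 * (s u \<bullet> (R *\<^sub>v f u)) + s u \<bullet> (R *\<^sub>v s u)" for u
    using f[of u] s[of u] Rc sym[OF f[of u] s[of u]]
    by (simp add: mult_minus_distrib_mat_vec_real[of _ n n] scalar_prod_minus_distrib[of _ n]
        minus_scalar_prod_distrib[of _ n])
  have i1: "((\<lambda>u. f u \<bullet> (R *\<^sub>v f u)) has_integral integral {0..1} (\<lambda>u. f u \<bullet> (R *\<^sub>v f u))) {0..1}"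
    using continuous_on_quadratic_form[OF Rc f cont] by (intro integrable_integral integrable_continuous_real)
  have i2: "((\<lambda>u. s u \<bullet> (R *\<^sub>v f u)) has_integral E) {0..1}"
  proof -
    have "((\<lambda>u. \<Sum>q\<le>N. (2 * real q + 1) * (poly (legendre q) u * (f u \<bullet> (R *\<^sub>v ?c q)))) has_integral E) {0..1}"
      unfolding E_def using Rc
      by (intro has_integral_sum has_integral_mult_right has_integral_legendre_scalar_prod cont) auto
    thus ?thesis
      by (simp add: s_form[OF f] a_def mult.assoc)
  qed
  have i3: "((\<lambda>u. s u \<bullet> (R *\<^sub>v s u)) has_integral E) {0..1}"
  proof -
    have orth: "((\<lambda>u. a q u * a p u) has_integral (if q = p then 2 * real q + 1 else 0)) {0..1}" for q p
    proof -
      have "(poly (legendre q * legendre p) has_integral integral01 (legendre q * legendre p)) {0..1}"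
        unfolding integral01_def by (intro integrable_integral poly_integrable)
      hence "((\<lambda>u. (2 * real q + 1) * (2 * real p + 1) * poly (legendre q * legendre p) u) has_integral
          (2 * real q + 1) * (2 * real p + 1) * integral01 (legendre q * legendre p)) {0..1}"
        by (rule has_integral_mult_right)
      moreover have "(2 * real q + 1) * (2 * real p + 1) * integral01 (legendre q * legendre p) =
          (if q = p then 2 * real q + 1 else 0)"
        by (auto simp: legendre_orthogonal)
      ultimately show ?thesis
        by (simp add: a_def mult_ac)
    qed
    have "((\<lambda>u. \<Sum>q\<le>N. \<Sum>p\<le>N. a q u * a p u * (?c p \<bullet> (R *\<^sub>v ?c q))) has_integral
        (\<Sum>q\<le>N. \<Sum>p\<le>N. (if q = p then 2 * real q + 1 else 0) * (?c p \<bullet> (R *\<^sub>v ?c q)))) {0..1}"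
      by (intro has_integral_sum has_integral_mult_left orth) auto
    also have "(\<Sum>q\<le>N. \<Sum>p\<le>N. (if q = p then 2 * real q + 1 else 0) * (?c p \<bullet> (R *\<^sub>v ?c q))) = E"
    proof -
      have "(\<Sum>p\<le>N. (if q = p then 2 * real q + 1 else 0) * (?c p \<bullet> (R *\<^sub>v ?c q))) =
          (2 * real q + 1) * (?c q \<bullet> (R *\<^sub>v ?c q))" if "q \<le> N" for q
        using that by (subst sum.remove[of _ q]) (auto intro!: sum.neutral)
      thus ?thesis unfolding E_def by simp
    qed
    also have "(\<lambda>u. \<Sum>q\<le>N. \<Sum>p\<le>N. a q u * a p u * (?c p \<bullet> (R *\<^sub>v ?c q))) = (\<lambda>u. s u \<bullet> (R *\<^sub>v s u))"
    proof
      fix u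
      have "s u \<bullet> (R *\<^sub>v ?c q) = (\<Sum>p\<le>N. a p u * (?c p \<bullet> (R *\<^sub>v ?c q)))" for q
        using Rc by (intro s_prod) auto
      thus "(\<Sum>q\<le>N. \<Sum>p\<le>N. a q u * a p u * (?c p \<bullet> (R *\<^sub>v ?c q))) = s u \<bullet> (R *\<^sub>v s u)"
        by (simp add: s_form[OF s] sum_distrib_left mult.assoc)
    qed
    finally show ?thesis .
  qed
  \<comment> \<open>The cross term and the square of the projection integrate to the same number E,
    so the nonnegative total is the integral of the form at f minus E.\<close>
  have "((\<lambda>u. (f u - s u) \<bullet> (R *\<^sub>v (f u - s u))) has_integral
      integral {0..1} (\<lambda>u. f u \<bullet> (R *\<^sub>v f u)) - 2 * E + E) {0..1}"
    unfolding expand by (intro has_integral_add has_integral_diff has_integral_mult_right i1 i2 i3)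
  moreover have "0 \<le> (f u - s u) \<bullet> (R *\<^sub>v (f u - s u))" for u
    using f s by (intro posdef_mat_nonneg[OF R]) auto
  ultimately have "0 \<le> integral {0..1} (\<lambda>u. f u \<bullet> (R *\<^sub>v f u)) - 2 * E + E"
    by (rule has_integral_nonneg)
  thus ?thesis by (simp add: E_def)
qed

text \<open>Differentiation under the integral sign, followed by integration by parts and the expansion of the
  derivative of a Legendre polynomial in Legendre polynomials.\<close>

lemma deriv_legendre_moment:
  fixes z w :: "real \<Rightarrow> real"
  assumes h: "h > 0" and t: "t > h" and cz: "continuous_on UNIV z" and cw: "continuous_on UNIV w"
    and dz: "\<And>t. t > 0 \<Longrightarrow> (z has_real_derivative w t) (at t)"
  defines "m \<equiv> \<lambda>k t. integral {0..1} (\<lambda>u. poly (legendre k) u * z (t - h + h * u))"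
  shows "(m q has_real_derivative integral {0..1} (\<lambda>u. poly (legendre q) u * w (t - h + h * u))) (at t)"
    and "h * integral {0..1} (\<lambda>u. poly (legendre q) u * w (t - h + h * u)) =
      z t + (-1) ^ (q + 1) * z (t - h) + (\<Sum>k<q. gamma_coeff q k * m k t)"
proof -
  let ?W = "integral {0..1} (\<lambda>u. poly (legendre q) u * w (t - h + h * u))"
  \<comment> \<open>This is where t > h is needed: the whole delay interval must lie where z is
    differentiable.\<close>
  have pos: "x - h + h * u > 0" if "x > h" "u \<in> {0..1}" for x u
  proof -
    have "0 \<le> h * u" using h that by auto
    thus ?thesis using that by linarith
  qed
  have cz': "continuous_on S (\<lambda>u. z (g u))" if "continuous_on S g" for g :: "'a::topological_space \<Rightarrow> real" and S
    by (rule continuous_on_compose2[OF cz that]) auto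
  have cw': "continuous_on S (\<lambda>u. w (g u))" if "continuous_on S g" for g :: "'a::topological_space \<Rightarrow> real" and S
    by (rule continuous_on_compose2[OF cw that]) auto
  have "(m q has_real_derivative integral (cbox 0 1) (\<lambda>u. poly (legendre q) u * w (t - h + h * u))) (at t within {h<..})"
    unfolding m_def cbox_interval[symmetric]
  proof (rule leibniz_rule_field_derivative)
    fix x u :: real assume xu: "x \<in> {h<..}" "u \<in> cbox 0 1"
    have "((\<lambda>x. z (x - h + h * u)) has_real_derivative w (x - h + h * u) * 1) (at x)"
      by (rule DERIV_chain2[OF dz]) (use xu pos in \<open>auto intro!: derivative_eq_intros\<close>)
    thus "((\<lambda>x. poly (legendre q) u * z (x - h + h * u)) has_real_derivative
        poly (legendre q) u * w (x - h + h * u)) (at x within {h<..})"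
      by (intro DERIV_cmult) (auto intro: has_field_derivative_at_within)
  next
    show "(\<lambda>u. poly (legendre q) u * z (x - h + h * u)) integrable_on cbox 0 1" for x
      by (intro integrable_continuous continuous_intros cz')
  next
    show "continuous_on ({h<..} \<times> cbox 0 1) (\<lambda>(x, u). poly (legendre q) u * w (x - h + h * u))"
      unfolding split_beta by (intro continuous_intros cw')
  qed (use t in auto)
  thus "(m q has_real_derivative ?W) (at t)"
    using t by (simp add: at_within_open[of t "{h<..}"])
  \<comment> \<open>The fundamental theorem for the product of \<open>legendre q\<close> with the
    shifted z. The endpoint values 1 and (-1)^q produce the state and delayed-state entries of
    \<open>Gamma_vec\<close>.\<close>
  have "((\<lambda>u. poly (pderiv (legendre q)) u * z (t - h + h * u) + h * (poly (legendre q) u * w (t - h + h * u))) has_integral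
      poly (legendre q) 1 * z (t - h + h * 1) - poly (legendre q) 0 * z (t - h + h * 0)) {0..1}"
  proof (rule fundamental_theorem_of_calculus)
    fix u :: real assume u: "u \<in> {0..1}"
    have "((\<lambda>u. z (t - h + h * u)) has_real_derivative w (t - h + h * u) * h) (at u)"
      by (rule DERIV_chain2[OF dz]) (use pos[OF t u] in \<open>auto intro!: derivative_eq_intros\<close>)
    from has_field_derivative_at_within[OF DERIV_mult[OF poly_DERIV this]]
    show "((\<lambda>u. poly (legendre q) u * z (t - h + h * u)) has_vector_derivative
       poly (pderiv (legendre q)) u * z (t - h + h * u) + h * (poly (legendre q) u * w (t - h + h * u))) (at u within {0..1})"
      unfolding has_real_derivative_iff_has_vector_derivative[symmetric]
      by (simp add: mult_ac)
  qed simp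
  moreover have "((\<lambda>u. poly (pderiv (legendre q)) u * z (t - h + h * u)) has_integral
      - (\<Sum>k<q. gamma_coeff q k * m k t)) {0..1}"
  proof -
    have "((\<lambda>u. poly (legendre k) u * z (t - h + h * u)) has_integral m k t) {0..1}" for k
      unfolding m_def by (intro integrable_integral integrable_continuous_real continuous_intros cz')
    hence "((\<lambda>u. - (\<Sum>k<q. gamma_coeff q k * (poly (legendre k) u * z (t - h + h * u)))) has_integral
        - (\<Sum>k<q. gamma_coeff q k * m k t)) {0..1}"
      by (intro has_integral_neg has_integral_sum has_integral_mult_right) auto
    thus ?thesis
      by (simp add: pderiv_legendre poly_sum sum_distrib_right mult.assoc)
  qed
  moreover have "((\<lambda>u. h * (poly (legendre q) u * w (t - h + h * u))) has_integral h * ?W) {0..1}"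
    by (intro has_integral_mult_right integrable_integral integrable_continuous_real continuous_intros cw')
  ultimately have "poly (legendre q) 1 * z (t - h + h * 1) - poly (legendre q) 0 * z (t - h + h * 0) =
      - (\<Sum>k<q. gamma_coeff q k * m k t) + h * ?W"
    by (intro has_integral_unique[OF _ has_integral_add])
  thus "h * ?W = z t + (-1) ^ (q + 1) * z (t - h) + (\<Sum>k<q. gamma_coeff q k * m k t)"
    by (simp add: legendre_at_0 legendre_at_1)
qed

lemma vec_cont_on_compose:
  assumes "vec_cont_on n UNIV f" "continuous_on U g"
  shows "vec_cont_on n U (\<lambda>u. f (g u))"
  using assms unfolding vec_cont_on_def by (auto intro: continuous_on_compose2[of UNIV])

lemma vec_cont_on_add:
  assumes "vec_cont_on n U f" "vec_cont_on n U g" "\<And>t. g t \<in> carrier_vec n"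
  shows "vec_cont_on n U (\<lambda>t. f t + g t)"
  using assms unfolding vec_cont_on_def by (auto simp: carrier_vecD[OF assms(3)] intro!: continuous_intros)

lemma has_vec_deriv_block_vec:
  assumes "\<And>a. a < p \<Longrightarrow> has_vec_deriv n (\<lambda>s. f s a) (f' a) t"
  shows "has_vec_deriv (p * n) (\<lambda>s. block_vec n p (f s)) (block_vec n p f') t"
  unfolding has_vec_deriv_def
proof (intro allI impI)
  fix i assume i: "i < p * n"
  hence "n > 0" by (cases n) auto
  hence "i div n < p" "i mod n < n"
    using i by (auto simp: less_mult_imp_div_less)
  with i assms show "((\<lambda>s. block_vec n p (f s) $ i) has_real_derivative block_vec n p f' $ i) (at t)"
    by (auto simp: block_vec_def has_vec_deriv_def)
qed

lemma scalar_prod_add_self_le: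
  fixes v w :: "real vec"
  assumes "v \<in> carrier_vec n" "w \<in> carrier_vec n"
  shows "(v + w) \<bullet> (v + w) \<le> 2 * (v \<bullet> v) + 2 * (w \<bullet> w)"
  using abs_scalar_prod_le[OF assms] assms comm_scalar_prod[OF assms]
  by (simp add: scalar_prod_add_distrib[of _ n] add_scalar_prod_distrib[of _ n])

text \<open>On the diagonal k = q the coefficient vanishes by parity. Hence only moments of index
  below q enter, and even for q = N the N moments stored in \<xi> are enough.\<close>

lemma gamma_coeff_ge: "q \<le> k \<Longrightarrow> gamma_coeff q k = 0"
  by (cases "k = q") (auto simp: gamma_coeff_def simp flip: mult_2)

section \<open>The Lyapunov--Krasovskii functional\<close>

text \<open>The value of the quadratic form of \<open>Phi_mat\<close> at \<open>xi_vec\<close>.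
  Written without large matrices, it is the interface between the algebraic part and the estimates
  along solutions.\<close>

definition lk_rate :: "nat \<Rightarrow> nat \<Rightarrow> real \<Rightarrow> real mat \<Rightarrow> real mat \<Rightarrow> real mat \<Rightarrow>
    real vec \<Rightarrow> real vec \<Rightarrow> real vec \<Rightarrow> (nat \<Rightarrow> real vec) \<Rightarrow> real" where
  "lk_rate n N h P S R w z zd \<mu> =
      2 * (block_vec n (N + 1) (\<lambda>a. if a = 0 then z else h \<cdot>\<^sub>v \<mu> (a - 1)) \<bullet>
        (P *\<^sub>v block_vec n (N + 1) (\<lambda>a. if a = 0 then w else Gamma_vec n N z zd \<mu> (a - 1))))
      + z \<bullet> (S *\<^sub>v z) - zd \<bullet> (S *\<^sub>v zd) + h\<^sup>2 * (w \<bullet> (R *\<^sub>v w))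
      - (\<Sum>q\<le>N. (2 * real q + 1) * (Gamma_vec n N z zd \<mu> q \<bullet> (R *\<^sub>v Gamma_vec n N z zd \<mu> q)))"

section \<open>Solutions of the delay equation: growth over one delay and moments\<close>

locale delay_system =
  fixes n :: nat and h :: real and A Ad :: "real mat"
  assumes h: "h > 0" and A: "A \<in> carrier_mat n n" and Ad: "Ad \<in> carrier_mat n n"
begin

definition vfield :: "(real \<Rightarrow> real vec) \<Rightarrow> real \<Rightarrow> real vec" where
  "vfield z t = A *\<^sub>v z t + Ad *\<^sub>v z (t - h)"

text \<open>Solutions are continued arbitrarily, but continuously, to the left of \<open>-h\<close>, so that \<open>vfield z\<close> is
  continuous on the whole line.\<close>

definition solution :: "(real \<Rightarrow> real vec) \<Rightarrow> bool" where
  "solution z \<longleftrightarrow> (\<forall>t. z t \<in> carrier_vec n) \<and> vec_cont_on n UNIV z \<and>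
     (\<forall>t>0. has_vec_deriv n z (vfield z t) t)"

lemma solutionD:
  assumes "solution z"
  shows "z t \<in> carrier_vec n" "vfield z t \<in> carrier_vec n" "vec_cont_on n UNIV z" "vec_cont_on n UNIV (vfield z)"
    "t > 0 \<Longrightarrow> has_vec_deriv n z (vfield z t) t"
proof -
  show c: "z t \<in> carrier_vec n" and cont: "vec_cont_on n UNIV z" for t
    using assms by (auto simp: solution_def)
  show "vfield z t \<in> carrier_vec n"
    using c A Ad by (auto simp: vfield_def)
  have "vec_cont_on n UNIV (\<lambda>t. z (t - h))"
    by (intro vec_cont_on_compose[OF cont] continuous_intros)
  thus "vec_cont_on n UNIV (vfield z)"
    unfolding vfield_def[abs_def] using c A Ad
    by (intro vec_cont_on_add vec_cont_on_mult_mat_vec[of _ n n] cont) auto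
  show "t > 0 \<Longrightarrow> has_vec_deriv n z (vfield z t) t"
    using assms by (auto simp: solution_def)
qed

lemma scalar_prod_vfield_bound:
  "\<exists>c>0. \<forall>z t. solution z \<longrightarrow> \<bar>z t \<bullet> vfield z t\<bar> \<le> c * (z t \<bullet> z t + z (t - h) \<bullet> z (t - h))"
proof -
  obtain a where a: "a > 0" "\<And>v w. v \<in> carrier_vec n \<Longrightarrow> w \<in> carrier_vec n \<Longrightarrow> \<bar>v \<bullet> (A *\<^sub>v w)\<bar> \<le> a * (v \<bullet> v + w \<bullet> w)"
    using bilinear_form_bound[OF A] by blast
  obtain b where b: "b > 0" "\<And>v w. v \<in> carrier_vec n \<Longrightarrow> w \<in> carrier_vec n \<Longrightarrow> \<bar>v \<bullet> (Ad *\<^sub>v w)\<bar> \<le> b * (v \<bullet> v + w \<bullet> w)"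
    using bilinear_form_bound[OF Ad] by blast
  have "\<bar>z t \<bullet> vfield z t\<bar> \<le> (2 * a + b) * (z t \<bullet> z t + z (t - h) \<bullet> z (t - h))" if sol: "solution z" for z t
  proof -
    note c = solutionD(1)[OF sol]
    have "z t \<bullet> vfield z t = z t \<bullet> (A *\<^sub>v z t) + z t \<bullet> (Ad *\<^sub>v z (t - h))"
      unfolding vfield_def using c A Ad by (intro scalar_prod_add_distrib[of _ n]) auto
    hence "\<bar>z t \<bullet> vfield z t\<bar> \<le> a * (z t \<bullet> z t + z t \<bullet> z t) + b * (z t \<bullet> z t + z (t - h) \<bullet> z (t - h))"
      using a(2)[OF c c, of t t] b(2)[OF c c, of t "t - h"] by linarith
    also have "\<dots> \<le> (2 * a + b) * (z t \<bullet> z t + z (t - h) \<bullet> z (t - h))"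
      using a(1) scalar_prod_self_nonneg[of "z (t - h)"] by (simp add: algebra_simps)
    finally show ?thesis .
  qed
  thus ?thesis
    using a(1) b(1) by (intro exI[of _ "2 * a + b"]) auto
qed

lemma deriv_norm_sq:
  assumes "solution z" "t > 0"
  shows "((\<lambda>t. z t \<bullet> z t) has_real_derivative 2 * (z t \<bullet> vfield z t)) (at t)"
proof -
  have "((\<lambda>t. z t \<bullet> z t) has_real_derivative vfield z t \<bullet> z t + z t \<bullet> vfield z t) (at t)"
    using solutionD[OF assms(1)] assms(2) by (intro has_real_derivative_scalar_prod) auto
  thus ?thesis
    using comm_scalar_prod[of "z t" n "vfield z t"] solutionD(1,2)[OF assms(1)] by simp
qed

text \<open>On [a, a + h] the delayed argument stays in [a - h, a], where D bounds it, so Gronwall's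
  argument for an ordinary differential inequality applies. The constant depends on the system
  alone.\<close>

lemma growth_bound:
  "\<exists>C\<ge>1. \<forall>z a D. solution z \<longrightarrow> a \<ge> 0 \<longrightarrow> (\<forall>t\<in>{a - h..a}. z t \<bullet> z t \<le> D) \<longrightarrow>
     (\<forall>t\<in>{a..a + h}. z t \<bullet> z t \<le> C * D)"
proof -
  obtain c where c: "c > 0"
    "\<And>z t. solution z \<Longrightarrow> \<bar>z t \<bullet> vfield z t\<bar> \<le> c * (z t \<bullet> z t + z (t - h) \<bullet> z (t - h))"
    using scalar_prod_vfield_bound by blast
  \<comment> \<open>The factor 2 comes from adding D to |z|^2, whose value at a is itself at most
    D.\<close>
  define C where "C = 2 * exp (2 * c * h)"
  have "C \<ge> 1"
  proof -
    have "1 \<le> exp (2 * c * h)"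
      using c(1) h by simp
    thus ?thesis unfolding C_def by linarith
  qed
  moreover have "z t \<bullet> z t \<le> C * D"
    if sol: "solution z" and a: "a \<ge> 0" and D: "\<And>t. t \<in> {a - h..a} \<Longrightarrow> z t \<bullet> z t \<le> D" and t: "t \<in> {a..a + h}" for z a D t
  proof -
    \<comment> \<open>The derivative of |z|^2 is at most 2c (|z|^2 + D), so the exponential weight
      makes u nonincreasing.\<close>
    define u where "u t = (z t \<bullet> z t + D) * exp (- 2 * c * (t - a))" for t
    have D0: "D \<ge> 0"
      using D[of a] h scalar_prod_self_nonneg[of "z a"] by auto
    have cont: "continuous_on S (\<lambda>t. z t \<bullet> z t)" for S
      using solutionD(1,3)[OF sol] continuous_on_subset[OF continuous_on_scalar_prod[of z n UNIV z]] by auto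
    have "u t \<le> u a"
    \<comment> \<open>Only interior derivatives are used, which admits a = 0, where the solution
      need not be differentiable.\<close>
    proof (rule DERIV_nonpos_imp_decreasing_open[of a t u])
      fix x assume x: "a < x" "x < t"
      hence "x > 0" "z (x - h) \<bullet> z (x - h) \<le> D"
        using a t D by auto
      have "(u has_real_derivative 2 * (z x \<bullet> vfield z x) * exp (- 2 * c * (x - a))
          + (- 2 * c * exp (- 2 * c * (x - a))) * (z x \<bullet> z x + D)) (at x)"
        unfolding u_def[abs_def]
        by (rule DERIV_mult) (auto intro!: derivative_eq_intros deriv_norm_sq[OF sol \<open>x > 0\<close>])
      moreover have "2 * (z x \<bullet> vfield z x) * exp (- 2 * c * (x - a))
          + (- 2 * c * exp (- 2 * c * (x - a))) * (z x \<bullet> z x + D)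
          = 2 * exp (- 2 * c * (x - a)) * (z x \<bullet> vfield z x - c * (z x \<bullet> z x + D))"
        by (simp add: algebra_simps)
      moreover have "z x \<bullet> vfield z x - c * (z x \<bullet> z x + D) \<le> 0"
      proof -
        have "c * (z x \<bullet> z x + z (x - h) \<bullet> z (x - h)) \<le> c * (z x \<bullet> z x + D)"
          using c(1) \<open>z (x - h) \<bullet> z (x - h) \<le> D\<close> by (intro mult_left_mono) auto
        thus ?thesis using c(2)[OF sol, of x] by linarith
      qed
      ultimately show "\<exists>y. (u has_real_derivative y) (at x) \<and> y \<le> 0"
        by (metis mult_nonneg_nonpos exp_ge_zero mult_nonneg_nonneg zero_le_numeral)
    next
      show "continuous_on {a..t} u"
        unfolding u_def[abs_def] by (intro continuous_intros cont)
    qed (use t in auto)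
    hence "(z t \<bullet> z t + D) * exp (- 2 * c * (t - a)) \<le> 2 * D"
      using D[of a] h by (simp add: u_def)
    hence "(z t \<bullet> z t + D) * exp (- 2 * c * (t - a)) * exp (2 * c * (t - a)) \<le> 2 * D * exp (2 * c * (t - a))"
      by (intro mult_right_mono) auto
    moreover have "exp (- 2 * c * (t - a)) * exp (2 * c * (t - a)) = 1"
      by (simp flip: exp_add)
    ultimately have "z t \<bullet> z t + D \<le> 2 * D * exp (2 * c * (t - a))"
      by (simp only: mult.assoc mult_1_right)
    also have "\<dots> \<le> 2 * D * exp (2 * c * h)"
      using t D0 c(1) by (intro mult_left_mono) auto
    finally show ?thesis
      using D0 by (simp add: C_def mult_ac)
  qed
  ultimately show ?thesis by blast
qed

text \<open>The delay interval is rescaled to [0, 1]; the integral over [t - h, t] itself is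
  \<open>h\<close> times this, which explains the factor \<open>h\<close> in \<open>G_mat\<close>
  and in the extended state.\<close>

definition moment :: "(real \<Rightarrow> real vec) \<Rightarrow> nat \<Rightarrow> real \<Rightarrow> real vec" where
  "moment z k t = legendre_coeff n (\<lambda>u. z (t - h + h * u)) k"

lemma moment_carrier [simp]: "moment z k t \<in> carrier_vec n"
  by (simp add: moment_def)

text \<open>Differentiation under the integral and integration by parts identify the same vector in
  two ways: the first form is what Bessel's inequality needs, the second what the derivative of the
  extended state needs. The case q = N serves only the former.\<close>

lemma moment_deriv:
  assumes sol: "solution z" and t: "t > h" and q: "q \<le> N"
  defines "g \<equiv> Gamma_vec n N (z t) (z (t - h)) (\<lambda>k. moment z k t) q"
  shows "g = h \<cdot>\<^sub>v legendre_coeff n (\<lambda>u. vfield z (t - h + h * u)) q"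
    and "has_vec_deriv n (\<lambda>t. h \<cdot>\<^sub>v moment z q t) g t"
proof -
  note s = solutionD[OF sol]
  have comp: "g $ i = h * legendre_coeff n (\<lambda>u. vfield z (t - h + h * u)) q $ i"
    "((\<lambda>t. moment z q t $ i) has_real_derivative legendre_coeff n (\<lambda>u. vfield z (t - h + h * u)) q $ i) (at t)"
    if i: "i < n" for i
  proof -
    have c: "continuous_on UNIV (\<lambda>t. z t $ i)" "continuous_on UNIV (\<lambda>t. vfield z t $ i)"
      and d: "\<And>t. t > 0 \<Longrightarrow> ((\<lambda>t. z t $ i) has_real_derivative vfield z t $ i) (at t)"
      using s(3-5) i by (auto simp: vec_cont_on_def has_vec_deriv_def)
    note m = deriv_legendre_moment[OF h t c d, where q = q]
    show "((\<lambda>t. moment z q t $ i) has_real_derivative legendre_coeff n (\<lambda>u. vfield z (t - h + h * u)) q $ i) (at t)"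
      using m(1) i by (simp add: moment_def legendre_coeff_def)
    have "(\<Sum>k<N. gamma_coeff q k * moment z k t $ i) = (\<Sum>k<q. gamma_coeff q k * moment z k t $ i)"
      using q by (intro sum.mono_neutral_right) (auto simp: gamma_coeff_ge)
    thus "g $ i = h * legendre_coeff n (\<lambda>u. vfield z (t - h + h * u)) q $ i"
      using m(2) i by (simp add: g_def Gamma_vec_def moment_def legendre_coeff_def)
  qed
  show "g = h \<cdot>\<^sub>v legendre_coeff n (\<lambda>u. vfield z (t - h + h * u)) q"
    by (rule eq_vecI) (use comp(1) in \<open>auto simp: g_def legendre_coeff_def Gamma_vec_def\<close>)
  show "has_vec_deriv n (\<lambda>t. h \<cdot>\<^sub>v moment z q t) g t"
    unfolding has_vec_deriv_def
  proof (intro allI impI)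
    fix i assume i: "i < n"
    have "((\<lambda>t. h * moment z q t $ i) has_real_derivative g $ i) (at t)"
      unfolding comp(1)[OF i] by (intro DERIV_cmult comp(2) i)
    thus "((\<lambda>t. (h \<cdot>\<^sub>v moment z q t) $ i) has_real_derivative g $ i) (at t)"
      using i by (simp add: carrier_vecD[OF moment_carrier])
  qed
qed

definition extended_state :: "nat \<Rightarrow> (real \<Rightarrow> real vec) \<Rightarrow> real \<Rightarrow> real vec" where
  "extended_state N z t = block_vec n (N + 1) (\<lambda>a. if a = 0 then z t else h \<cdot>\<^sub>v moment z (a - 1) t)"

lemma extended_state_carrier: "extended_state N z t \<in> carrier_vec ((N + 1) * n)"
  unfolding extended_state_def by (rule block_vec_carrier)

lemma extended_state_norm:
  assumes "solution z"
  shows "extended_state N z t \<bullet> extended_state N z t = z t \<bullet> z t + (\<Sum>k<N. h\<^sup>2 * (moment z k t \<bullet> moment z k t))"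
proof -
  have "extended_state N z t \<bullet> extended_state N z t =
      (\<Sum>a<Suc N. (if a = 0 then z t else h \<cdot>\<^sub>v moment z (a - 1) t) \<bullet> (if a = 0 then z t else h \<cdot>\<^sub>v moment z (a - 1) t))"
    unfolding extended_state_def Suc_eq_plus1 using solutionD(1)[OF assms] by (intro scalar_prod_block_vec) auto
  thus ?thesis
    by (simp add: sum.lessThan_Suc_shift power2_eq_square mult.assoc carrier_vecD[OF moment_carrier] del: sum.lessThan_Suc)
qed

text \<open>Bessel's inequality for the identity matrix, after discarding the weights 2q + 1 \<ge>
  1; the bound therefore does not grow with N.\<close>

lemma moments_le:
  assumes sol: "solution z" and D: "\<And>s. s \<in> {t - h..t} \<Longrightarrow> z s \<bullet> z s \<le> D"
  shows "(\<Sum>k<N. moment z k t \<bullet> moment z k t) \<le> D"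
proof -
  note s = solutionD[OF sol]
  let ?f = "\<lambda>u. z (t - h + h * u)"
  have one: "posdef_mat n (1\<^sub>m n)"
    unfolding posdef_mat_def
  proof (intro conjI ballI impI)
    fix v :: "real vec" assume v: "v \<in> carrier_vec n" "v \<noteq> 0\<^sub>v n"
    then obtain i where "i < n" "v $ i \<noteq> 0"
      by (metis carrier_vecD eq_vecI index_zero_vec(1,2))
    with component_le_scalar_prod_self[OF v(1)] have "0 < v \<bullet> v"
      by (metis less_le_trans zero_less_power2)
    thus "0 < v \<bullet> (1\<^sub>m n *\<^sub>v v)"
      using v by simp
  qed auto
  have f: "?f u \<in> carrier_vec n" for u by (rule s(1))
  have cf: "vec_cont_on n {0..1} ?f"
    by (intro vec_cont_on_compose[OF s(3)] continuous_intros)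
  have "(\<Sum>k<N. moment z k t \<bullet> moment z k t) \<le>
      (\<Sum>q\<le>N. (2 * real q + 1) * (legendre_coeff n ?f q \<bullet> (1\<^sub>m n *\<^sub>v legendre_coeff n ?f q)))"
  proof (rule order.trans[OF sum_mono2[of "{..N}"] sum_mono])
    fix q
    show "moment z q t \<bullet> moment z q t \<le> (2 * real q + 1) * (legendre_coeff n ?f q \<bullet> (1\<^sub>m n *\<^sub>v legendre_coeff n ?f q))"
      using scalar_prod_self_nonneg[of "legendre_coeff n ?f q"]
      by (simp add: moment_def algebra_simps)
  qed (auto simp: scalar_prod_self_nonneg)
  also have "\<dots> \<le> integral {0..1} (\<lambda>u. ?f u \<bullet> (1\<^sub>m n *\<^sub>v ?f u))"
    by (rule bessel_legendre[OF one f cf])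
  also have "\<dots> \<le> integral {0..1 :: real} (\<lambda>u. D)"
  proof (rule integral_le)
    show "(\<lambda>u. ?f u \<bullet> (1\<^sub>m n *\<^sub>v ?f u)) integrable_on {0..1}"
      by (intro integrable_continuous_real continuous_on_quadratic_form[of _ n] f cf) auto
    fix u :: real assume "u \<in> {0..1}"
    hence "h * u \<le> h * 1" "0 \<le> h * u"
      using h by (intro mult_left_mono mult_nonneg_nonneg; auto)+
    thus "?f u \<bullet> (1\<^sub>m n *\<^sub>v ?f u) \<le> D"
      using f D by simp
  qed auto
  finally show ?thesis by simp
qed

end

section \<open>Consequences of the dissipation inequality\<close>

locale delay_lmi = delay_system +
  fixes N :: nat and e :: real and P S R :: "real mat"
  assumes e: "e > 0" and P: "posdef_mat ((N + 1) * n) P" and S: "posdef_mat n S" and R: "posdef_mat n R"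
    and dissipation: "\<And>z zd \<mu>. z \<in> carrier_vec n \<Longrightarrow> zd \<in> carrier_vec n \<Longrightarrow> (\<And>k. \<mu> k \<in> carrier_vec n) \<Longrightarrow>
      lk_rate n N h P S R (A *\<^sub>v z + Ad *\<^sub>v zd) z zd \<mu> \<le> - e * (z \<bullet> z)"
begin

lemma PSR:
  "P \<in> carrier_mat ((N + 1) * n) ((N + 1) * n)" "transpose_mat P = P"
  "S \<in> carrier_mat n n" "R \<in> carrier_mat n n"
  using P S R by (auto simp: posdef_mat_def)

lemma extended_state_deriv:
  assumes sol: "solution z" and t: "t > h"
  shows "has_vec_deriv ((N + 1) * n) (extended_state N z) (block_vec n (N + 1)
    (\<lambda>a. if a = 0 then vfield z t else Gamma_vec n N (z t) (z (t - h)) (\<lambda>k. moment z k t) (a - 1))) t"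
  unfolding extended_state_def[abs_def]
proof (rule has_vec_deriv_block_vec)
  fix a assume "a < N + 1"
  moreover have "t > 0" using t h by linarith
  ultimately show "has_vec_deriv n (\<lambda>s. if a = 0 then z s else h \<cdot>\<^sub>v moment z (a - 1) s)
      (if a = 0 then vfield z t else Gamma_vec n N (z t) (z (t - h)) (\<lambda>k. moment z k t) (a - 1)) t"
    using solutionD(5)[OF sol] moment_deriv(2)[OF sol t, of "a - 1" N] by auto
qed

text \<open>The primitives \<open>QS\<close> and \<open>QR\<close> of \<open>z \<bullet> S z\<close> and \<open>w \<bullet> R w\<close>, and \<open>QQ\<close> of \<open>QR\<close>, turn the two integral terms of the
  functional into differences: its last term is
  \<open>h \<integral>\<^bsub>[t - h, t]\<^esub> (s - t + h) (w \<bullet> R w)(s) ds\<close>, integrated by parts.\<close>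

definition lk_functional :: "(real \<Rightarrow> real) \<Rightarrow> (real \<Rightarrow> real) \<Rightarrow> (real \<Rightarrow> real) \<Rightarrow> (real \<Rightarrow> real vec) \<Rightarrow> real \<Rightarrow> real" where
  "lk_functional QS QR QQ z t = extended_state N z t \<bullet> (P *\<^sub>v extended_state N z t)
     + (QS t - QS (t - h)) + h * (h * QR t - (QQ t - QQ (t - h)))"

lemma lk_functional_deriv:
  assumes sol: "solution z" and t: "t > h"
    and QS: "\<And>t. t > 0 \<Longrightarrow> (QS has_real_derivative z t \<bullet> (S *\<^sub>v z t)) (at t)"
    and QR: "\<And>t. t > 0 \<Longrightarrow> (QR has_real_derivative vfield z t \<bullet> (R *\<^sub>v vfield z t)) (at t)"
    and QQ: "\<And>t. t > 0 \<Longrightarrow> (QQ has_real_derivative QR t) (at t)"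
  shows "\<exists>d \<le> - e * (z t \<bullet> z t). (lk_functional QS QR QQ z has_real_derivative d) (at t)"
proof -
  note s = solutionD[OF sol]
  have t': "t > 0" "t - h > 0" using t h by auto
  let ?w = "vfield z" and ?\<mu> = "\<lambda>k. moment z k t"
  let ?g = "Gamma_vec n N (z t) (z (t - h)) ?\<mu>"
  let ?f = "\<lambda>u. ?w (t - h + h * u)"
  let ?z' = "block_vec n (N + 1) (\<lambda>a. if a = 0 then ?w t else ?g (a - 1))"
  define I where "I = integral {0..1} (\<lambda>u. ?f u \<bullet> (R *\<^sub>v ?f u))"
  have d1: "((\<lambda>t. extended_state N z t \<bullet> (P *\<^sub>v extended_state N z t)) has_real_derivative
      2 * (extended_state N z t \<bullet> (P *\<^sub>v ?z'))) (at t)"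
    using extended_state_deriv[OF sol t] PSR
    by (intro has_real_derivative_quadratic_form[of P "(N + 1) * n"])
      (simp_all only: extended_state_carrier block_vec_carrier)
  have shift: "((\<lambda>s. F (s - h)) has_real_derivative F' (t - h)) (at t)"
    if "\<And>t. t > 0 \<Longrightarrow> (F has_real_derivative F' t) (at t)" for F F' :: "real \<Rightarrow> real"
    using that[OF t'(2)] DERIV_shift[of F "F' (t - h)" t "- h"] by simp
  \<comment> \<open>Since QQ' = QR, the last term contributes h^2 (w \<bullet> R w) minus h times
    the increment of QR over the delay interval; Bessel's inequality bounds that increment from
    below.\<close>
  have d: "(lk_functional QS QR QQ z has_real_derivative
      2 * (extended_state N z t \<bullet> (P *\<^sub>v ?z')) + (z t \<bullet> (S *\<^sub>v z t) - z (t - h) \<bullet> (S *\<^sub>v z (t - h)))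
      + h * (h * (?w t \<bullet> (R *\<^sub>v ?w t)) - (QR t - QR (t - h)))) (at t)"
    unfolding lk_functional_def[abs_def]
    by (intro DERIV_add DERIV_diff DERIV_cmult d1 QS QR QQ shift[of QS] shift[of QQ] t')
  have "((\<lambda>u. h * (?f u \<bullet> (R *\<^sub>v ?f u))) has_integral QR (t - h + h * 1) - QR (t - h + h * 0)) {0..1}"
  proof (rule fundamental_theorem_of_calculus)
    fix u :: real assume "u \<in> {0..1}"
    hence "0 \<le> h * u" using h by auto
    hence pos: "t - h + h * u > 0" using t' by linarith
    have "((\<lambda>u. QR (t - h + h * u)) has_real_derivative ?f u \<bullet> (R *\<^sub>v ?f u) * h) (at u)"
      by (rule DERIV_chain2[OF QR]) (use pos in \<open>auto intro!: derivative_eq_intros\<close>)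
    from has_field_derivative_at_within[OF this]
    show "((\<lambda>u. QR (t - h + h * u)) has_vector_derivative h * (?f u \<bullet> (R *\<^sub>v ?f u))) (at u within {0..1})"
      unfolding has_real_derivative_iff_has_vector_derivative[symmetric] by (simp add: mult.commute)
  qed simp
  moreover have cf: "vec_cont_on n {0..1} ?f"
    by (intro vec_cont_on_compose[OF s(4)] continuous_intros)
  hence "((\<lambda>u. h * (?f u \<bullet> (R *\<^sub>v ?f u))) has_integral h * I) {0..1}"
    unfolding I_def
    by (intro has_integral_mult_right integrable_integral integrable_continuous_real
        continuous_on_quadratic_form[OF PSR(4)] s(2))
  ultimately have "QR (t - h + h * 1) - QR (t - h + h * 0) = h * I"
    by (rule has_integral_unique)
  hence QRI: "QR t - QR (t - h) = h * I" by simp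
  \<comment> \<open>Each \<open>?g q\<close> carries a factor \<open>h\<close>, so the sum has the
    factor h^2, the same as h times the increment h I of QR.\<close>
  have "(\<Sum>q\<le>N. (2 * real q + 1) * (?g q \<bullet> (R *\<^sub>v ?g q))) =
      h\<^sup>2 * (\<Sum>q\<le>N. (2 * real q + 1) * (legendre_coeff n ?f q \<bullet> (R *\<^sub>v legendre_coeff n ?f q)))"
    unfolding sum_distrib_left
  proof (rule sum.cong[OF refl])
    fix q assume "q \<in> {..N}"
    hence q: "?g q = h \<cdot>\<^sub>v legendre_coeff n ?f q"
      using moment_deriv(1)[OF sol t] by simp
    show "(2 * real q + 1) * (?g q \<bullet> (R *\<^sub>v ?g q)) =
        h\<^sup>2 * ((2 * real q + 1) * (legendre_coeff n ?f q \<bullet> (R *\<^sub>v legendre_coeff n ?f q)))"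
      unfolding q using PSR(4) by (simp add: mult_mat_vec[of _ n n] power2_eq_square carrier_vecD[OF legendre_coeff_carrier])
  qed
  also have "\<dots> \<le> h\<^sup>2 * I"
    unfolding I_def by (intro mult_left_mono bessel_legendre[OF R s(2) cf]) auto
  finally have "2 * (extended_state N z t \<bullet> (P *\<^sub>v ?z')) + (z t \<bullet> (S *\<^sub>v z t) - z (t - h) \<bullet> (S *\<^sub>v z (t - h)))
      + h * (h * (?w t \<bullet> (R *\<^sub>v ?w t)) - (QR t - QR (t - h))) \<le> lk_rate n N h P S R (?w t) (z t) (z (t - h)) ?\<mu>"
    unfolding lk_rate_def QRI extended_state_def by (simp add: algebra_simps power2_eq_square)
  also have "\<dots> \<le> - e * (z t \<bullet> z t)"
    using dissipation[OF s(1) s(1), of ?\<mu> t "t - h"] by (simp add: vfield_def)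
  finally show ?thesis
    using d by blast
qed

text \<open>The mean value theorem, applied once to QS and twice to the double primitive, replaces
  the integral terms by point values of the forms. Their sign gives the lower bound of the
  functional and their size the upper bound.\<close>

lemma lk_functional_terms:
  assumes sol: "solution z" and t: "t > h"
    and QS: "\<And>t. t > 0 \<Longrightarrow> (QS has_real_derivative z t \<bullet> (S *\<^sub>v z t)) (at t)"
    and QR: "\<And>t. t > 0 \<Longrightarrow> (QR has_real_derivative vfield z t \<bullet> (R *\<^sub>v vfield z t)) (at t)"
    and QQ: "\<And>t. t > 0 \<Longrightarrow> (QQ has_real_derivative QR t) (at t)"
  shows "\<exists>s\<in>{t - h..t}. \<exists>r\<in>{t - h..t}. \<exists>c\<in>{0..h}. lk_functional QS QR QQ z t =
    extended_state N z t \<bullet> (P *\<^sub>v extended_state N z t) + h * (z s \<bullet> (S *\<^sub>v z s))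
    + h * h * c * (vfield z r \<bullet> (R *\<^sub>v vfield z r))"
proof -
  obtain s where s: "t - h < s" "s < t" "QS t - QS (t - h) = (t - (t - h)) * (z s \<bullet> (S *\<^sub>v z s))"
    using MVT2[of "t - h" t QS "\<lambda>s. z s \<bullet> (S *\<^sub>v z s)"] QS h t by auto
  obtain x where x: "t - h < x" "x < t" "QQ t - QQ (t - h) = (t - (t - h)) * QR x"
    using MVT2[of "t - h" t QQ QR] QQ h t by auto
  obtain r where r: "x < r" "r < t" "QR t - QR x = (t - x) * (vfield z r \<bullet> (R *\<^sub>v vfield z r))"
    using MVT2[of x t QR "\<lambda>s. vfield z s \<bullet> (R *\<^sub>v vfield z s)"] QR x h t by auto
  have "h * (h * QR t - (QQ t - QQ (t - h))) = h * h * (QR t - QR x)"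
    unfolding x(3) by (simp add: algebra_simps)
  hence "lk_functional QS QR QQ z t = extended_state N z t \<bullet> (P *\<^sub>v extended_state N z t) + h * (z s \<bullet> (S *\<^sub>v z s))
    + h * h * (t - x) * (vfield z r \<bullet> (R *\<^sub>v vfield z r))"
    unfolding lk_functional_def s(3) r(3) by simp
  moreover have "s \<in> {t - h..t}" "r \<in> {t - h..t}" "t - x \<in> {0..h}"
    using s r x by auto
  ultimately show ?thesis by blast
qed

text \<open>Hides the primitives, which vary with the solution, behind constants p and c that do
  not. The lower bound keeps only the P term; the upper bound is stated at 2h alone, where
  everything that enters is determined by z on [0, 2h].\<close>

lemma ex_lyapunov_function:
  "\<exists>p>0. \<exists>c>0. \<forall>z. solution z \<longrightarrow> (\<exists>V V'.
     (\<forall>t>h. (V has_real_derivative V' t) (at t) \<and> V' t \<le> - e * (z t \<bullet> z t) \<and> p * (z t \<bullet> z t) \<le> V t) \<and>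
     (\<forall>D. (\<forall>t\<in>{0..2 * h}. z t \<bullet> z t \<le> D) \<longrightarrow> V (2 * h) \<le> c * D))"
proof -
  obtain p where p: "p > 0" "\<And>v. v \<in> carrier_vec ((N + 1) * n) \<Longrightarrow> p * (v \<bullet> v) \<le> v \<bullet> (P *\<^sub>v v)"
    using posdef_mat_coercive[OF P] by blast
  have upper: "\<exists>c>0. \<forall>v\<in>carrier_vec k. v \<bullet> (M *\<^sub>v v) \<le> c * (v \<bullet> v)" if M: "M \<in> carrier_mat k k" for k and M :: "real mat"
  proof -
    obtain c where c: "c > 0" "\<And>v w. v \<in> carrier_vec k \<Longrightarrow> w \<in> carrier_vec k \<Longrightarrow> \<bar>v \<bullet> (M *\<^sub>v w)\<bar> \<le> c * (v \<bullet> v + w \<bullet> w)"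
      using bilinear_form_bound[OF M] by blast
    have "v \<bullet> (M *\<^sub>v v) \<le> (2 * c) * (v \<bullet> v)" if "v \<in> carrier_vec k" for v
      using c(2)[OF that that] by simp
    thus ?thesis using c(1) by (intro exI[of _ "2 * c"]) auto
  qed
  obtain cP where cP: "cP > 0" "\<And>v. v \<in> carrier_vec ((N + 1) * n) \<Longrightarrow> v \<bullet> (P *\<^sub>v v) \<le> cP * (v \<bullet> v)"
    using upper[OF PSR(1)] by blast
  obtain cS where cS: "cS > 0" "\<And>v. v \<in> carrier_vec n \<Longrightarrow> v \<bullet> (S *\<^sub>v v) \<le> cS * (v \<bullet> v)"
    using upper[OF PSR(3)] by blast
  obtain cR where cR: "cR > 0" "\<And>v. v \<in> carrier_vec n \<Longrightarrow> v \<bullet> (R *\<^sub>v v) \<le> cR * (v \<bullet> v)"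
    using upper[OF PSR(4)] by blast
  obtain cA where cA: "cA > 0" "\<And>v. v \<in> carrier_vec n \<Longrightarrow> (A *\<^sub>v v) \<bullet> (A *\<^sub>v v) \<le> cA * (v \<bullet> v)"
    using mult_mat_vec_bound[OF A] by blast
  obtain cD where cD: "cD > 0" "\<And>v. v \<in> carrier_vec n \<Longrightarrow> (Ad *\<^sub>v v) \<bullet> (Ad *\<^sub>v v) \<le> cD * (v \<bullet> v)"
    using mult_mat_vec_bound[OF Ad] by blast
  \<comment> \<open>One summand per term of the functional. The factors 2 come from |v + w|^2 \<le>
    2 |v|^2 + 2 |w|^2, applied to the two parts of the vector field.\<close>
  define c where "c = cP * (1 + h\<^sup>2) + h * cS + h * h * h * (cR * (2 * cA + 2 * cD))"
  have "\<exists>V V'.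
     (\<forall>t>h. (V has_real_derivative V' t) (at t) \<and> V' t \<le> - e * (z t \<bullet> z t) \<and> p * (z t \<bullet> z t) \<le> V t) \<and>
     (\<forall>D. (\<forall>t\<in>{0..2 * h}. z t \<bullet> z t \<le> D) \<longrightarrow> V (2 * h) \<le> c * D)"
    if sol: "solution z" for z
  proof -
    note s = solutionD[OF sol]
    have "continuous_on UNIV (\<lambda>t. z t \<bullet> (S *\<^sub>v z t))" "continuous_on UNIV (\<lambda>t. vfield z t \<bullet> (R *\<^sub>v vfield z t))"
      using continuous_on_quadratic_form[OF PSR(3) s(1,3)] continuous_on_quadratic_form[OF PSR(4) s(2,4)] by auto
    \<comment> \<open>QR starts from -1, so that it is continuous on the closed half-line from 0, as
      required for taking its own primitive QQ.\<close>
    from continuous_on_subset[OF this(1)] continuous_on_subset[OF this(2)]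
    obtain QS QR where QS: "\<And>t. t > 0 \<Longrightarrow> (QS has_real_derivative z t \<bullet> (S *\<^sub>v z t)) (at t)"
      and QR: "\<And>t. t > - 1 \<Longrightarrow> (QR has_real_derivative vfield z t \<bullet> (R *\<^sub>v vfield z t)) (at t)"
      using ex_primitive[of 0 "\<lambda>t. z t \<bullet> (S *\<^sub>v z t)"] ex_primitive[of "- 1" "\<lambda>t. vfield z t \<bullet> (R *\<^sub>v vfield z t)"]
      by blast
    have "continuous_on {0..} QR"
      by (rule DERIV_continuous_on, rule has_field_derivative_at_within, rule QR) auto
    then obtain QQ where QQ: "\<And>t. t > 0 \<Longrightarrow> (QQ has_real_derivative QR t) (at t)"
      using ex_primitive by blast
    have QR: "\<And>t. t > 0 \<Longrightarrow> (QR has_real_derivative vfield z t \<bullet> (R *\<^sub>v vfield z t)) (at t)"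
      using QR by auto
    define V where "V = lk_functional QS QR QQ z"
    have "\<forall>t. \<exists>d. t > h \<longrightarrow> d \<le> - e * (z t \<bullet> z t) \<and> (V has_real_derivative d) (at t)"
      unfolding V_def using lk_functional_deriv[OF sol _ QS QR QQ] by blast
    then obtain V' where V': "\<And>t. t > h \<Longrightarrow> V' t \<le> - e * (z t \<bullet> z t)" "\<And>t. t > h \<Longrightarrow> (V has_real_derivative V' t) (at t)"
      by metis
    note E = extended_state_carrier[of N z]
    have low: "p * (z t \<bullet> z t) \<le> V t" if t: "t > h" for t
    proof -
      obtain s r c where V: "c \<in> {0..h}" "V t =
          extended_state N z t \<bullet> (P *\<^sub>v extended_state N z t) + h * (z s \<bullet> (S *\<^sub>v z s))
          + h * h * c * (vfield z r \<bullet> (R *\<^sub>v vfield z r))"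
        using lk_functional_terms[OF sol t QS QR QQ] unfolding V_def by blast
      have "0 \<le> h * (z s \<bullet> (S *\<^sub>v z s))" "0 \<le> h * h * c * (vfield z r \<bullet> (R *\<^sub>v vfield z r))"
        using h V(1) posdef_mat_nonneg[OF S solutionD(1)[OF sol], of s] posdef_mat_nonneg[OF R solutionD(2)[OF sol], of r]
        by auto
      moreover have "p * (z t \<bullet> z t) \<le> p * (extended_state N z t \<bullet> extended_state N z t)"
        unfolding extended_state_norm[OF sol] using p(1)
        by (intro mult_left_mono) (auto intro!: sum_nonneg mult_nonneg_nonneg scalar_prod_self_nonneg)
      ultimately show ?thesis
        using p(2)[OF E[of t]] V(2) by linarith
    qed
    have "V (2 * h) \<le> c * D" if D: "\<And>t. t \<in> {0..2 * h} \<Longrightarrow> z t \<bullet> z t \<le> D" for D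
    proof -
      have t: "2 * h > h" using h by simp
      have D0: "D \<ge> 0"
        using D[of 0] h scalar_prod_self_nonneg[of "z 0"] by auto
      obtain s r b where V: "s \<in> {2 * h - h..2 * h}" "r \<in> {2 * h - h..2 * h}" "b \<in> {0..h}" "V (2 * h) =
          extended_state N z (2 * h) \<bullet> (P *\<^sub>v extended_state N z (2 * h)) + h * (z s \<bullet> (S *\<^sub>v z s))
          + h * h * b * (vfield z r \<bullet> (R *\<^sub>v vfield z r))"
        using lk_functional_terms[OF sol t QS QR QQ] unfolding V_def by blast
      have "extended_state N z (2 * h) \<bullet> extended_state N z (2 * h) \<le> D + h\<^sup>2 * D"
        unfolding extended_state_norm[OF sol] sum_distrib_left[symmetric]
        using h D by (intro add_mono mult_left_mono moments_le[OF sol]) auto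
      hence 1: "extended_state N z (2 * h) \<bullet> (P *\<^sub>v extended_state N z (2 * h)) \<le> cP * (D + h\<^sup>2 * D)"
        using cP(2)[OF E[of "2 * h"]] cP(1) by (meson mult_left_mono less_imp_le order.trans)
      have "z s \<bullet> (S *\<^sub>v z s) \<le> cS * (z s \<bullet> z s)"
        by (rule cS(2)[OF solutionD(1)[OF sol]])
      also have "\<dots> \<le> cS * D"
        using V(1) h cS(1) by (intro mult_left_mono D) auto
      finally have 2: "h * (z s \<bullet> (S *\<^sub>v z s)) \<le> h * (cS * D)"
        using h by (intro mult_left_mono) auto
      have "vfield z r \<bullet> vfield z r \<le> 2 * ((A *\<^sub>v z r) \<bullet> (A *\<^sub>v z r)) + 2 * ((Ad *\<^sub>v z (r - h)) \<bullet> (Ad *\<^sub>v z (r - h)))"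
        unfolding vfield_def using A Ad solutionD(1)[OF sol] by (intro scalar_prod_add_self_le[of _ n]) auto
      also have "\<dots> \<le> 2 * (cA * (z r \<bullet> z r)) + 2 * (cD * (z (r - h) \<bullet> z (r - h)))"
        using cA(2)[OF solutionD(1)[OF sol], of r] cD(2)[OF solutionD(1)[OF sol], of "r - h"] by simp
      also have "\<dots> \<le> 2 * (cA * D) + 2 * (cD * D)"
        using V(2) h cA(1) cD(1) by (intro add_mono mult_left_mono D) auto
      finally have "cR * (vfield z r \<bullet> vfield z r) \<le> cR * (2 * (cA * D) + 2 * (cD * D))"
        using cR(1) by (intro mult_left_mono) auto
      hence "vfield z r \<bullet> (R *\<^sub>v vfield z r) \<le> cR * (2 * (cA * D) + 2 * (cD * D))"
        using cR(2)[OF solutionD(2)[OF sol], of r] by linarith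
      hence "h * h * b * (vfield z r \<bullet> (R *\<^sub>v vfield z r)) \<le> h * h * h * (cR * (2 * (cA * D) + 2 * (cD * D)))"
        using h V(3) posdef_mat_nonneg[OF R solutionD(2)[OF sol], of r] by (intro mult_mono mult_left_mono) auto
      with 1 2 V(4) show ?thesis
        by (simp add: c_def algebra_simps)
    qed
    with V' low show ?thesis by blast
  qed
  moreover have "c > 0"
    unfolding c_def using cP(1) cS(1) cR(1) cA(1) cD(1) h
    by (intro add_pos_pos mult_pos_pos) auto
  ultimately show ?thesis
    using p(1) by blast
qed

text \<open>The growth bound, used on [0, h] and again on [h, 2h], gives the factor C^2; C \<ge> 1
  lets it serve both intervals. After 2h the function V no longer increases, so its value there,
  divided by p, bounds |z|^2. The constant is the larger of the two factors.\<close>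

lemma uniform_bound:
  "\<exists>c>0. \<forall>z D. solution z \<longrightarrow> (\<forall>t\<in>{-h..0}. z t \<bullet> z t \<le> D) \<longrightarrow> (\<forall>t\<ge>0. z t \<bullet> z t \<le> c * D)"
proof -
  obtain C where C: "C \<ge> 1" "\<And>z a D t. solution z \<Longrightarrow> a \<ge> 0 \<Longrightarrow> \<forall>t\<in>{a - h..a}. z t \<bullet> z t \<le> D \<Longrightarrow>
     t \<in> {a..a + h} \<Longrightarrow> z t \<bullet> z t \<le> C * D"
    using growth_bound by blast
  obtain p c where pc: "p > 0" "c > 0" "\<And>z. solution z \<Longrightarrow> \<exists>V V'.
     (\<forall>t>h. (V has_real_derivative V' t) (at t) \<and> V' t \<le> - e * (z t \<bullet> z t) \<and> p * (z t \<bullet> z t) \<le> V t) \<and>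
     (\<forall>D. (\<forall>t\<in>{0..2 * h}. z t \<bullet> z t \<le> D) \<longrightarrow> V (2 * h) \<le> c * D)"
    using ex_lyapunov_function by blast
  define K where "K = max (C * C) (c * (C * C) / p)"
  have "K > 0"
    using C(1) by (auto simp: K_def less_max_iff_disj)
  moreover have "z t \<bullet> z t \<le> K * D"
    if sol: "solution z" and D: "\<forall>t\<in>{-h..0}. z t \<bullet> z t \<le> D" and t: "t \<ge> 0" for z D t
  proof -
    have D0: "D \<ge> 0"
      using D h scalar_prod_self_nonneg[of "z 0"] by (auto dest: bspec[of _ _ 0])
    have "\<forall>t\<in>{0..0 + h}. z t \<bullet> z t \<le> C * D"
      using C(2)[OF sol, of 0 D] D by auto
    hence "\<forall>t\<in>{h - h..h}. z t \<bullet> z t \<le> C * D" by simp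
    hence "\<forall>t\<in>{h..2 * h}. z t \<bullet> z t \<le> C * (C * D)"
      using C(2)[OF sol, of h "C * D"] h by simp
    moreover have "C * D \<le> C * (C * D)"
      using C(1) D0 mult_right_mono[of 1 C "C * D"] by simp
    ultimately have CC: "\<forall>t\<in>{0..2 * h}. z t \<bullet> z t \<le> C * (C * D)"
      using \<open>\<forall>t\<in>{h - h..h}. z t \<bullet> z t \<le> C * D\<close> by (metis atLeastAtMost_iff diff_self linear order.trans)
    have K: "C * (C * D) \<le> K * D" "c * (C * (C * D)) / p \<le> K * D"
      unfolding K_def using D0 mult_right_mono[of "C * C" "max (C * C) (c * (C * C) / p)" D]
        mult_right_mono[of "c * (C * C) / p" "max (C * C) (c * (C * C) / p)" D] by (auto simp: mult.assoc)
    show ?thesis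
    proof (cases "t \<le> 2 * h")
      case True
      with CC t K(1) show ?thesis by (meson atLeastAtMost_iff order.trans)
    next
      case False
      obtain V V' where V: "\<And>t. t > h \<Longrightarrow> (V has_real_derivative V' t) (at t)" "\<And>t. t > h \<Longrightarrow> V' t \<le> - e * (z t \<bullet> z t)"
          "\<And>t. t > h \<Longrightarrow> p * (z t \<bullet> z t) \<le> V t"
          "\<And>D. (\<forall>t\<in>{0..2 * h}. z t \<bullet> z t \<le> D) \<Longrightarrow> V (2 * h) \<le> c * D"
        using pc(3)[OF sol] by blast
      have "V t \<le> V (2 * h)"
      proof (rule deriv_nonpos_imp_antimono[of "2 * h" t V V'])
        fix x assume "x \<in> {2 * h..t}"
        hence "x > h" using h by auto
        moreover have "- e * (z x \<bullet> z x) \<le> 0"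
          using e scalar_prod_self_nonneg[of "z x"] by simp
        ultimately show "V' x \<le> 0" using V(2)[of x] by linarith
      qed (use False h V(1) in auto)
      hence "p * (z t \<bullet> z t) \<le> c * (C * (C * D))"
        using V(3)[of t] V(4)[OF CC] False h by linarith
      hence "z t \<bullet> z t \<le> c * (C * (C * D)) / p"
        using pc(1) by (simp add: field_simps)
      with K(2) show ?thesis by linarith
    qed
  qed
  ultimately show ?thesis by blast
qed

text \<open>Barbalat's argument with g = |z|^2. The derivative of g is bounded for t > h because the
  uniform bound covers both t and t - h; the bound D on the initial interval exists by
  compactness.\<close>

lemma attractive:
  assumes sol: "solution z"
  shows "((\<lambda>t. z t \<bullet> z t) \<longlongrightarrow> 0) at_top"
proof -
  obtain p c where pc: "p > 0" "\<And>z. solution z \<Longrightarrow> \<exists>V V'.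
     (\<forall>t>h. (V has_real_derivative V' t) (at t) \<and> V' t \<le> - e * (z t \<bullet> z t) \<and> p * (z t \<bullet> z t) \<le> V t) \<and>
     (\<forall>D. (\<forall>t\<in>{0..2 * h}. z t \<bullet> z t \<le> D) \<longrightarrow> V (2 * h) \<le> c * D)"
    using ex_lyapunov_function by blast
  obtain V V' where V: "\<And>t. t > h \<Longrightarrow> (V has_real_derivative V' t) (at t)" "\<And>t. t > h \<Longrightarrow> V' t \<le> - e * (z t \<bullet> z t)"
      "\<And>t. t > h \<Longrightarrow> p * (z t \<bullet> z t) \<le> V t"
    using pc(2)[OF sol] by blast
  obtain b where b: "b > 0"
    "\<And>t. \<bar>z t \<bullet> vfield z t\<bar> \<le> b * (z t \<bullet> z t + z (t - h) \<bullet> z (t - h))"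
    using scalar_prod_vfield_bound sol by blast
  have "continuous_on {-h..0} (\<lambda>t. z t \<bullet> z t)"
    using solutionD(1,3)[OF sol] continuous_on_subset[OF continuous_on_scalar_prod[of z n UNIV z]] by auto
  from compact_continuous_image[OF this] have "bdd_above ((\<lambda>t. z t \<bullet> z t) ` {-h..0})"
    by (intro bounded_imp_bdd_above compact_imp_bounded) auto
  then obtain D where D: "\<forall>t\<in>{-h..0}. z t \<bullet> z t \<le> D"
    by (auto simp: bdd_above_def)
  obtain K where K: "\<And>t. t \<ge> 0 \<Longrightarrow> z t \<bullet> z t \<le> K * D"
    using uniform_bound sol D by blast
  have bound: "\<bar>2 * (z t \<bullet> vfield z t)\<bar> \<le> 2 * (b * (K * D + K * D))" if "t > h" for t
  proof -
    have "b * (z t \<bullet> z t + z (t - h) \<bullet> z (t - h)) \<le> b * (K * D + K * D)"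
      using that h b(1) by (intro mult_left_mono add_mono K) auto
    with b(2)[of t] show ?thesis unfolding abs_mult abs_numeral by linarith
  qed
  show ?thesis
  proof (rule barbalat_dissipation[of h V V' e _ "\<lambda>t. 2 * (z t \<bullet> vfield z t)" "2 * (b * (K * D + K * D))"])
    show "0 \<le> V t" if "t > h" for t
      using V(3)[OF that] pc(1) scalar_prod_self_nonneg[of "z t"] by (meson mult_nonneg_nonneg less_imp_le order.trans)
    show "((\<lambda>t. z t \<bullet> z t) has_real_derivative 2 * (z t \<bullet> vfield z t)) (at t)" if "t > h" for t
      using that h by (intro deriv_norm_sq[OF sol]) auto
  qed (use V e bound scalar_prod_self_nonneg in auto)
qed

end

section \<open>Stability of the closed loop\<close>

lemma lk_rate_eq_Phi_form:
  assumes "w \<in> carrier_vec n" "z \<in> carrier_vec n" "zd \<in> carrier_vec n" "\<And>k. \<mu> k \<in> carrier_vec n"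
    and "P \<in> carrier_mat ((N + 1) * n) ((N + 1) * n)" "S \<in> carrier_mat n n" "R \<in> carrier_mat n n"
  shows "xi_vec n N w z zd \<mu> \<bullet> (Phi_mat n N h P S R *\<^sub>v xi_vec n N w z zd \<mu>) = lk_rate n N h P S R w z zd \<mu>"
  unfolding lk_rate_def by (rule Phi_mat_form(2)) (use assms in auto)

lemma xi_norm_ge:
  assumes "w \<in> carrier_vec n" "z \<in> carrier_vec n" "zd \<in> carrier_vec n" "\<And>k. \<mu> k \<in> carrier_vec n"
  shows "z \<bullet> z \<le> xi_vec n N w z zd \<mu> \<bullet> xi_vec n N w z zd \<mu>"
proof -
  let ?b = "\<lambda>b. if b = 0 then w else if b = 1 then z else if b = 2 then zd else \<mu> (b - 3)"
  have "xi_vec n N w z zd \<mu> \<bullet> xi_vec n N w z zd \<mu> = (\<Sum>b<N + 3. ?b b \<bullet> ?b b)"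
    unfolding xi_vec_def by (rule scalar_prod_block_vec) (use assms in auto)
  also have "\<dots> \<ge> ?b 1 \<bullet> ?b 1"
    by (rule member_le_sum[of 1 "{..<N + 3}" "\<lambda>b. ?b b \<bullet> ?b b"]) (auto simp: scalar_prod_self_nonneg)
  finally show ?thesis by simp
qed

text \<open>If \<open>\<sigma> = 0\<close>, the matrix of the LMI takes the value \<open>h\<^sup>2 (v \<bullet> R v)\<close> at \<open>\<xi> = (v, 0, \<dots>, 0)\<close>; so it cannot be
  negative definite unless \<open>n = 0\<close>.\<close>

lemma lk_rate_derivative_only:
  assumes v: "v \<in> carrier_vec n" and P: "P \<in> carrier_mat ((N + 1) * n) ((N + 1) * n)"
    and S: "S \<in> carrier_mat n n" and R: "R \<in> carrier_mat n n"
  shows "lk_rate n N h P S R v (0\<^sub>v n) (0\<^sub>v n) (\<lambda>_. 0\<^sub>v n) = h\<^sup>2 * (v \<bullet> (R *\<^sub>v v))"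
proof -
  have G: "Gamma_vec n N (0\<^sub>v n) (0\<^sub>v n) (\<lambda>_. 0\<^sub>v n) q = 0\<^sub>v n" for q
    by (rule eq_vecI) (auto simp: Gamma_vec_def)
  have Z: "block_vec n (N + 1) (\<lambda>a. if a = 0 then 0\<^sub>v n else h \<cdot>\<^sub>v 0\<^sub>v n) = 0\<^sub>v ((N + 1) * n)"
    by (rule block_vec_eqI[symmetric]) (auto simp: block_index_less simp del: mult_Suc)
  have "0\<^sub>v ((N + 1) * n) \<bullet> (P *\<^sub>v block_vec n (N + 1) f) = 0" for f
    by (intro scalar_prod_left_zero mult_mat_vec_carrier[OF P] block_vec_carrier)
  moreover have "0\<^sub>v n \<bullet> (M *\<^sub>v 0\<^sub>v n) = 0" if "M \<in> carrier_mat n n" for M :: "real mat"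
    using that by (intro scalar_prod_left_zero mult_mat_vec_carrier) auto
  ultimately show ?thesis
    unfolding lk_rate_def Z G using S R by simp
qed

theorem corollary3:
  fixes n m p N :: nat
    and h \<sigma> :: real
    and A B C T Tinv At Bt Ct P S R Kbar :: "real mat"
    and D :: jordan_data
    and eps :: "nat \<Rightarrow> nat \<Rightarrow> real"
  assumes "A \<in> carrier_mat n n" "B \<in> carrier_mat n m" "C \<in> carrier_mat p n"
    and "N > 0" "h > 0"
    and "T \<in> carrier_mat n n" "Tinv \<in> carrier_mat n n"
    and "inverts_mat T Tinv" "inverts_mat Tinv T"
    and "At = Tinv * A * T" "Bt = Tinv * B" "Ct = C * T"
    and "jordan_data_ok D" "Tinv * (- A) * T = real_jordan_matrix D"
    and "posdef_mat ((N + 1) * n) P" "posdef_mat n S" "posdef_mat n R"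
    and "Kbar \<in> carrier_mat m p"
    and "negdef_mat ((N + 3) * n)
           (Phi_mat n N h P S R +
            He (transpose_mat (\<sigma> \<cdot>\<^sub>m M_mat n N At + delayed_mat n N (- (Bt * Kbar * Ct)))
                * FW_mat n N (jordan_sizes D) eps))"
  shows "asymptotically_stable n h A B C (inverse \<sigma> \<cdot>\<^sub>m Kbar)"
proof -
  note A' = assms(1) and B = assms(2) and C = assms(3) and h = assms(5) and T = assms(6) and Ti = assms(7)
    and Kb = assms(18)
  define K where "K = inverse \<sigma> \<cdot>\<^sub>m Kbar"
  define X where "X = Bt * Kbar * Ct"
  \<comment> \<open>The delayed feedback term B K C in the coordinates z, with \<open>Kbar\<close>
    divided by \<sigma>.\<close>
  define Ad where "Ad = inverse \<sigma> \<cdot>\<^sub>m X"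
  have At: "At \<in> carrier_mat n n" and Bt: "Bt \<in> carrier_mat n m" and Ct: "Ct \<in> carrier_mat p n"
    using assms by auto
  have X: "X \<in> carrier_mat n n" and Ad: "Ad \<in> carrier_mat n n"
    using Bt Ct Kb by (auto simp: X_def Ad_def)
  have P: "P \<in> carrier_mat ((N + 1) * n) ((N + 1) * n)" and S: "S \<in> carrier_mat n n" and R: "R \<in> carrier_mat n n"
    using assms(15-17) by (auto simp: posdef_mat_def)
  have TTi: "T * Tinv = 1\<^sub>m n"
    using assms(8) T by (auto simp: inverts_mat_def)
  let ?W = "FW_mat n N (jordan_sizes D) eps"
  let ?Phi = "Phi_mat n N h P S R"
  let ?Q = "He (transpose_mat (\<sigma> \<cdot>\<^sub>m M_mat n N At + delayed_mat n N (- X)) * ?W)"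
  let ?xi = "xi_vec n N"
  have W: "?W \<in> carrier_mat n ((N + 3) * n)"
    unfolding FW_mat_def by (rule block_mat_carrier[of n n 1, unfolded mult_1])
  obtain e where e: "e > 0" "\<And>v. v \<in> carrier_vec ((N + 3) * n) \<Longrightarrow> v \<bullet> ((?Phi + ?Q) *\<^sub>v v) \<le> - e * (v \<bullet> v)"
    using negdef_mat_coercive[OF assms(19)] unfolding X_def by blast
  \<comment> \<open>Here w is any vector satisfying the equation multiplied by \<sigma>. This
    freedom allows w to be the right-hand side of the closed loop and also, when \<sigma> = 0, a
    unit vector.\<close>
  have rate: "lk_rate n N h P S R w z zd \<mu> \<le> - e * (?xi w z zd \<mu> \<bullet> ?xi w z zd \<mu>)"
    if c: "w \<in> carrier_vec n" "z \<in> carrier_vec n" "zd \<in> carrier_vec n" "\<And>k. \<mu> k \<in> carrier_vec n"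
      and zero: "\<sigma> \<cdot>\<^sub>v (w - At *\<^sub>v z) + (- X) *\<^sub>v zd = 0\<^sub>v n" for w z zd \<mu>
  proof -
    let ?v = "?xi w z zd \<mu>"
    have v: "?v \<in> carrier_vec ((N + 3) * n)"
      by (rule xi_carrier) (use c in auto)
    have Phi: "?Phi \<in> carrier_mat ((N + 3) * n) ((N + 3) * n)"
      by (rule Phi_mat_form(1)[OF c(1-3) _ P S R]) (rule c(4))
    have mX: "- X \<in> carrier_mat n n" using X by simp
    note Q = slack_form_zero[OF c(1-3) _ At mX W zero, of \<mu>]
    have Q': "?Q \<in> carrier_mat ((N + 3) * n) ((N + 3) * n)" "?v \<bullet> (?Q *\<^sub>v ?v) = 0"
      using Q c(4) by blast+
    have "?v \<bullet> ((?Phi + ?Q) *\<^sub>v ?v) = ?v \<bullet> (?Phi *\<^sub>v ?v) + ?v \<bullet> (?Q *\<^sub>v ?v)"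
      unfolding add_mult_distrib_mat_vec[OF Phi Q'(1) v]
      by (rule scalar_prod_add_distrib[OF v mult_mat_vec_carrier[OF Phi v] mult_mat_vec_carrier[OF Q'(1) v]])
    thus ?thesis
      using e(2)[OF v] Q'(2) lk_rate_eq_Phi_form[OF c P S R] by simp
  qed
  have \<sigma>: "\<sigma> \<noteq> 0" if "n > 0"
  proof
    assume \<sigma>0: "\<sigma> = 0"
    let ?v = "unit_vec n 0 :: real vec"
    have "\<sigma> \<cdot>\<^sub>v (?v - At *\<^sub>v 0\<^sub>v n) + (- X) *\<^sub>v 0\<^sub>v n = 0\<^sub>v n"
      unfolding \<sigma>0 by (rule eq_vecI) (use At X in auto)
    from rate[OF _ _ _ _ this, of "\<lambda>_. 0\<^sub>v n"]
    have "h\<^sup>2 * (?v \<bullet> (R *\<^sub>v ?v)) \<le> - e * (?xi ?v (0\<^sub>v n) (0\<^sub>v n) (\<lambda>_. 0\<^sub>v n) \<bullet> ?xi ?v (0\<^sub>v n) (0\<^sub>v n) (\<lambda>_. 0\<^sub>v n))"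
      using lk_rate_derivative_only[of ?v n P N S R h] P S R by simp
    also have "\<dots> \<le> 0"
      using e(1) scalar_prod_self_nonneg by simp
    finally have "?v \<bullet> (R *\<^sub>v ?v) \<le> 0"
      using h by (simp add: mult_le_0_iff)
    moreover have "?v \<noteq> 0\<^sub>v n"
      using that by (metis index_unit_vec(1) index_zero_vec(1) zero_neq_one)
    hence "0 < ?v \<bullet> (R *\<^sub>v ?v)"
      using assms(17) by (auto simp: posdef_mat_def)
    ultimately show False by simp
  qed
  interpret delay_lmi n h At Ad N e P S R
  proof
    fix z zd :: "real vec" and \<mu> :: "nat \<Rightarrow> real vec"
    assume c: "z \<in> carrier_vec n" "zd \<in> carrier_vec n" "\<And>k. \<mu> k \<in> carrier_vec n"
    let ?w = "At *\<^sub>v z + Ad *\<^sub>v zd"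
    have w: "?w \<in> carrier_vec n" using At Ad c by auto
    have Xzd: "Ad *\<^sub>v zd = inverse \<sigma> \<cdot>\<^sub>v (X *\<^sub>v zd)"
      unfolding Ad_def using X c by (intro smult_mat_mult_vec) auto
    have "\<sigma> \<cdot>\<^sub>v (?w - At *\<^sub>v z) + (- X) *\<^sub>v zd = 0\<^sub>v n"
    proof (rule eq_vecI)
      fix i assume "i < dim_vec (0\<^sub>v n :: real vec)"
      hence i: "i < n" by simp
      \<comment> \<open>The index i < n is what guarantees n > 0; the case n = 0 needs no division
        by \<sigma>.\<close>
      hence "\<sigma> \<noteq> 0" using \<sigma> by simp
      thus "(\<sigma> \<cdot>\<^sub>v (?w - At *\<^sub>v z) + (- X) *\<^sub>v zd) $ i = 0\<^sub>v n $ i"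
        using i At X c unfolding Xzd by simp
    qed (use X in auto)
    from rate[OF w c this]
    have "lk_rate n N h P S R ?w z zd \<mu> \<le> - e * (?xi ?w z zd \<mu> \<bullet> ?xi ?w z zd \<mu>)" .
    also have "\<dots> \<le> - e * (z \<bullet> z)"
      using e(1) xi_norm_ge[OF w c, of N] by simp
    finally show "lk_rate n N h P S R ?w z zd \<mu> \<le> - e * (z \<bullet> z)" .
  qed (use h At Ad e(1) assms(15-17) in auto)

  obtain cT where cT: "cT > 0" "\<And>v. v \<in> carrier_vec n \<Longrightarrow> (T *\<^sub>v v) \<bullet> (T *\<^sub>v v) \<le> cT * (v \<bullet> v)"
    using mult_mat_vec_bound[OF T] by blast
  obtain cI where cI: "cI > 0" "\<And>v. v \<in> carrier_vec n \<Longrightarrow> (Tinv *\<^sub>v v) \<bullet> (Tinv *\<^sub>v v) \<le> cI * (v \<bullet> v)"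
    using mult_mat_vec_bound[OF Ti] by blast
  obtain c where c: "c > 0"
    "\<And>z D t. solution z \<Longrightarrow> \<forall>t\<in>{-h..0}. z t \<bullet> z t \<le> D \<Longrightarrow> t \<ge> 0 \<Longrightarrow> z t \<bullet> z t \<le> c * D"
    using uniform_bound by blast

  \<comment> \<open>Clamping the time continues x constantly to the left of -h, as
    \<open>solution\<close> asks for a continuous function on the whole line.\<close>
  define Z where "Z x t = Tinv *\<^sub>v x (max t (- h))" for x t
  have sol: "solution (Z x)" and xZ: "\<And>t. t \<ge> - h \<Longrightarrow> x t \<bullet> x t \<le> cT * (Z x t \<bullet> Z x t)"
    and Zx: "\<And>t. t \<ge> - h \<Longrightarrow> Z x t \<bullet> Z x t \<le> cI * (x t \<bullet> x t)"
    if "is_solution n h A B C K \<phi> x" for x \<phi>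
  proof -
    have xc: "\<And>t. t \<ge> - h \<Longrightarrow> x t \<in> carrier_vec n" and xcont: "\<And>i. i < n \<Longrightarrow> continuous_on {-h..} (\<lambda>t. x t $ i)"
      and xd: "\<And>t i. t > 0 \<Longrightarrow> i < n \<Longrightarrow>
        ((\<lambda>s. x s $ i) has_real_derivative (A *\<^sub>v x t + B *\<^sub>v (K *\<^sub>v (C *\<^sub>v x (t - h)))) $ i) (at t)"
      using that by (auto simp: is_solution_def Let_def)
    let ?x = "\<lambda>t. x (max t (- h))"
    have xc': "?x t \<in> carrier_vec n" for t by (rule xc) simp
    have TZ: "T *\<^sub>v (Tinv *\<^sub>v v) = v" if "v \<in> carrier_vec n" for v
      using TTi T Ti that by (simp flip: assoc_mult_mat_vec)
    show "x t \<bullet> x t \<le> cT * (Z x t \<bullet> Z x t)" if "t \<ge> - h" for t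
      using cT(2)[OF mult_mat_vec_carrier[OF Ti xc'[of t]]] TZ[OF xc'[of t]] that by (simp add: Z_def max_absorb1)
    show "Z x t \<bullet> Z x t \<le> cI * (x t \<bullet> x t)" if "t \<ge> - h" for t
      using cI(2)[OF xc'[of t]] that by (simp add: Z_def max_absorb1)
    show "solution (Z x)"
      unfolding solution_def
    proof (intro conjI allI impI)
      show "Z x t \<in> carrier_vec n" for t
        unfolding Z_def using Ti xc' by auto
      have "vec_cont_on n UNIV ?x"
        unfolding vec_cont_on_def
        by (intro allI impI continuous_on_compose2[OF xcont, of _ UNIV "\<lambda>t. max t (- h)"] continuous_intros) auto
      thus "vec_cont_on n UNIV (Z x)"
        unfolding Z_def[abs_def] by (intro vec_cont_on_mult_mat_vec[OF Ti xc'])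
      fix t :: real assume t: "t > 0"
      let ?y = "A *\<^sub>v x t + B *\<^sub>v (K *\<^sub>v (C *\<^sub>v x (t - h)))"
      have x1: "x t \<in> carrier_vec n" and x2: "x (t - h) \<in> carrier_vec n"
        using xc t h by auto
      have y: "?y \<in> carrier_vec n"
        by (intro carrier_vecI) (use B in auto)
      have "has_vec_deriv n ?x ?y t"
        unfolding has_vec_deriv_def
      proof (intro allI impI)
        fix i assume "i < n"
        from xd[OF t this] show "((\<lambda>s. ?x s $ i) has_real_derivative ?y $ i) (at t)"
          by (rule has_field_derivative_transform_within_open[of _ _ _ "{0<..}"]) (use t h in \<open>auto simp: max_absorb1\<close>)
      qed
      hence "has_vec_deriv n (Z x) (Tinv *\<^sub>v ?y) t"
        unfolding Z_def[abs_def] by (intro has_vec_deriv_mult_mat_vec[OF Ti xc' y])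
      \<comment> \<open>Inserting T Tinv = 1 in front of the state and the delayed state conjugates
        both coefficient matrices; the scalar 1/\<sigma> commutes past B and Tinv.\<close>
      moreover have "Tinv *\<^sub>v ?y = vfield (Z x) t"
      proof -
        have Cx: "C *\<^sub>v x (t - h) \<in> carrier_vec p"
          using C x2 by auto
        have KC: "K *\<^sub>v (C *\<^sub>v x (t - h)) = inverse \<sigma> \<cdot>\<^sub>v (Kbar *\<^sub>v (C *\<^sub>v x (t - h)))"
          unfolding K_def using Kb Cx by (intro smult_mat_mult_vec)
        have Z1: "Z x t = Tinv *\<^sub>v x t" and Z2: "Z x (t - h) = Tinv *\<^sub>v x (t - h)"
          using t h by (auto simp: Z_def max_absorb1)
        have c1: "A *\<^sub>v x t \<in> carrier_vec n" and c2: "Kbar *\<^sub>v (C *\<^sub>v x (t - h)) \<in> carrier_vec m"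
          and c3: "B *\<^sub>v (Kbar *\<^sub>v (C *\<^sub>v x (t - h))) \<in> carrier_vec n"
          and c4: "Tinv *\<^sub>v x t \<in> carrier_vec n" and c5: "Tinv *\<^sub>v x (t - h) \<in> carrier_vec n"
          using A' B Ti x1 x2 Kb Cx by auto
        have "At *\<^sub>v Z x t = Tinv *\<^sub>v (A *\<^sub>v (T *\<^sub>v (Tinv *\<^sub>v x t)))"
        proof -
          have "At *\<^sub>v (Tinv *\<^sub>v x t) = (Tinv * A) *\<^sub>v (T *\<^sub>v (Tinv *\<^sub>v x t))"
            unfolding assms(10) using Ti A' T c4 by (intro assoc_mult_mat_vec[of _ n n _ n]) auto
          also have "\<dots> = Tinv *\<^sub>v (A *\<^sub>v (T *\<^sub>v (Tinv *\<^sub>v x t)))"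
            using Ti A' T c4 by (intro assoc_mult_mat_vec[of _ n n _ n]) auto
          finally show ?thesis unfolding Z1 .
        qed
        hence 1: "At *\<^sub>v Z x t = Tinv *\<^sub>v (A *\<^sub>v x t)"
          unfolding TZ[OF x1] .
        have "X *\<^sub>v (Tinv *\<^sub>v x (t - h)) = (Bt * Kbar) *\<^sub>v (Ct *\<^sub>v (Tinv *\<^sub>v x (t - h)))"
          unfolding X_def using Bt Kb Ct c5 by (intro assoc_mult_mat_vec[of _ n p _ n]) auto
        also have "Ct *\<^sub>v (Tinv *\<^sub>v x (t - h)) = C *\<^sub>v (T *\<^sub>v (Tinv *\<^sub>v x (t - h)))"
          unfolding assms(12) using C T c5 by (intro assoc_mult_mat_vec) auto
        also have "\<dots> = C *\<^sub>v x (t - h)"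
          unfolding TZ[OF x2] ..
        also have "(Bt * Kbar) *\<^sub>v (C *\<^sub>v x (t - h)) = Bt *\<^sub>v (Kbar *\<^sub>v (C *\<^sub>v x (t - h)))"
          using Bt Kb Cx by (intro assoc_mult_mat_vec) auto
        also have "\<dots> = Tinv *\<^sub>v (B *\<^sub>v (Kbar *\<^sub>v (C *\<^sub>v x (t - h))))"
          unfolding assms(11) using Ti B c2 by (intro assoc_mult_mat_vec) auto
        finally have "Ad *\<^sub>v Z x (t - h) = inverse \<sigma> \<cdot>\<^sub>v (Tinv *\<^sub>v (B *\<^sub>v (Kbar *\<^sub>v (C *\<^sub>v x (t - h)))))"
          unfolding Ad_def Z2 smult_mat_mult_vec[OF X c5] by simp
        moreover have "Tinv *\<^sub>v (B *\<^sub>v (K *\<^sub>v (C *\<^sub>v x (t - h)))) =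
            inverse \<sigma> \<cdot>\<^sub>v (Tinv *\<^sub>v (B *\<^sub>v (Kbar *\<^sub>v (C *\<^sub>v x (t - h)))))"
          unfolding KC mult_mat_vec[OF B c2] mult_mat_vec[OF Ti c3] ..
        moreover have "Tinv *\<^sub>v ?y = Tinv *\<^sub>v (A *\<^sub>v x t) + Tinv *\<^sub>v (B *\<^sub>v (K *\<^sub>v (C *\<^sub>v x (t - h))))"
          using A' B by (intro mult_add_distrib_mat_vec[OF Ti] carrier_vecI) auto
        ultimately show ?thesis
          unfolding vfield_def 1 by simp
      qed
      ultimately show "has_vec_deriv n (Z x) (vfield (Z x) t) t"
        by simp
    qed
  qed

  show ?thesis
    unfolding asymptotically_stable_def K_def[symmetric]
  proof (intro conjI allI impI)
    fix r :: real assume r: "r > 0"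
    \<comment> \<open>The product of the losses in passing from x to z, along the solution, and back
      to x. Dividing by b + 1 in the choice of d makes b d^2 < r^2 strict.\<close>
    define b where "b = cT * (c * cI)"
    have b: "b > 0" using cT(1) c(1) cI(1) by (simp add: b_def)
    define d where "d = r / sqrt (b + 1)"
    have d2: "d\<^sup>2 = r\<^sup>2 / (b + 1)"
      using b by (simp add: d_def power_divide)
    have "d > 0" using r b by (simp add: d_def)
    moreover have "vec_nrm (x t) < r"
      if x: "is_solution n h A B C K \<phi> x" and \<phi>: "\<forall>t\<in>{-h..0}. vec_nrm (\<phi> t) < d" and t: "t \<ge> 0" for \<phi> x t
    proof -
      have "Z x s \<bullet> Z x s \<le> cI * d\<^sup>2" if s: "s \<in> {-h..0}" for s
      proof -
        have "sqrt (x s \<bullet> x s) < d"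
          using \<phi> x s by (auto simp: vec_nrm_def is_solution_def Let_def)
        hence "x s \<bullet> x s \<le> d\<^sup>2"
          using real_sqrt_pow2[OF scalar_prod_self_nonneg[of "x s"]] scalar_prod_self_nonneg[of "x s"]
          by (metis less_imp_le power_mono real_sqrt_ge_zero)
        with Zx[OF x, of s] s cI(1) show ?thesis
          by (auto intro: order.trans[OF _ mult_left_mono])
      qed
      hence "Z x t \<bullet> Z x t \<le> c * (cI * d\<^sup>2)"
        using c(2)[OF sol[OF x] _ t] by blast
      hence "cT * (Z x t \<bullet> Z x t) \<le> cT * (c * (cI * d\<^sup>2))"
        using cT(1) by (intro mult_left_mono) auto
      hence "x t \<bullet> x t \<le> b * d\<^sup>2"
        using xZ[OF x, of t] t h by (simp add: b_def mult.assoc)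
      also have "\<dots> < r\<^sup>2"
        using b r by (simp add: d2 field_simps)
      finally show ?thesis
        using r by (simp add: vec_nrm_def real_less_lsqrt scalar_prod_self_nonneg)
    qed
    ultimately show "\<exists>d>0. \<forall>\<phi> x. initial_condition n h \<phi> \<longrightarrow> is_solution n h A B C K \<phi> x \<longrightarrow>
        (\<forall>t \<in> {-h..0}. vec_nrm (\<phi> t) < d) \<longrightarrow> (\<forall>t\<ge>0. vec_nrm (x t) < r)"
      by blast
  next
    fix \<phi> x assume x: "is_solution n h A B C K \<phi> x"
    have lim: "((\<lambda>t. cT * (Z x t \<bullet> Z x t)) \<longlongrightarrow> cT * 0) at_top"
      by (intro tendsto_mult tendsto_const attractive[OF sol[OF x]])
    have "((\<lambda>t. x t \<bullet> x t) \<longlongrightarrow> 0) at_top"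
    proof (rule tendsto_sandwich[where f = "\<lambda>_. 0" and h = "\<lambda>t. cT * (Z x t \<bullet> Z x t)"])
      show "\<forall>\<^sub>F t in at_top. x t \<bullet> x t \<le> cT * (Z x t \<bullet> Z x t)"
        using xZ[OF x] by (intro eventually_at_top_linorderI[of "- h"]) auto
    qed (use lim in \<open>auto simp: scalar_prod_self_nonneg\<close>)
    from tendsto_real_sqrt[OF this] show "((\<lambda>t. vec_nrm (x t)) \<longlongrightarrow> 0) at_top"
      by (simp add: vec_nrm_def)
  qed
qed

end
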